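(* For every $3$-partite graph $G$ (i.e. every graph whose vertex set can be partitioned into three independent sets), $$\vec{\chi}(G)\leq \left\lceil \frac{\text{Mad}(G)}{2} \right\rceil+7.$$
   Context: Graphs are finite and simple. A proper orientation $D$ of a graph $G$ is an orientation of the edges of $G$ such that $d_D^+(u)\neq d_D^+(v)$ for every edge $uv\in E(G)$, where $d_D^+$ denotes out-degree in $D$. The proper orientation number $\vec{\chi}(G)$ is the minimum of $\Delta^+(D)$ (the maximum out-degree of $D$) over all proper orientations $D$ of $G$. The maximum average degree is $\text{Mad}(G)=\max_{H\subseteq G} \frac{2|E(H)|}{|V(H)|}$, the maximum over all (nonempty) subgraphs $H$ of $G$. *)

theory Defs
  imports Complex_Main "Graph_Theory.Graph_Theory"
begin

text \<open>
  A finite simple graph is a \<^locale>\<open>pair_graph\<close>: a finite, loop-free, symmetric digraph whose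
  arcs are pairs of vertices. An edge \<open>uv\<close> is thus represented by the two arcs \<open>(u, v)\<close> and
  \<open>(v, u)\<close>; \<open>uedges\<close> counts it once.
\<close>

definition uedges :: "'a pair_pre_digraph \<Rightarrow> 'a set set" where
  "uedges G = {{u, v} |u v. (u, v) \<in> parcs G}"

definition independent_set :: "'a pair_pre_digraph \<Rightarrow> 'a set \<Rightarrow> bool" where
  "independent_set G S \<longleftrightarrow> S \<subseteq> pverts G \<and> (\<forall>u\<in>S. \<forall>v\<in>S. (u, v) \<notin> parcs G)"

text \<open>Parts may be empty, so a bipartite graph is also 3-partite.\<close>

definition three_partite :: "'a pair_pre_digraph \<Rightarrow> bool" where
  "three_partite G \<longleftrightarrow>
     (\<exists>A B C. pverts G = A \<union> B \<union> C \<and> A \<inter> B = {} \<and> A \<inter> C = {} \<and> B \<inter> C = {} \<and>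
        independent_set G A \<and> independent_set G B \<and> independent_set G C)"

text \<open>An orientation keeps exactly one of the two arcs representing each edge.\<close>

definition orientation :: "'a pair_pre_digraph \<Rightarrow> 'a pair_pre_digraph \<Rightarrow> bool" where
  "orientation D G \<longleftrightarrow>
     pverts D = pverts G \<and> parcs D \<subseteq> parcs G \<and>
     (\<forall>u v. (u, v) \<in> parcs G \<longrightarrow> ((u, v) \<in> parcs D \<longleftrightarrow> (v, u) \<notin> parcs D))"

definition proper_orientation :: "'a pair_pre_digraph \<Rightarrow> 'a pair_pre_digraph \<Rightarrow> bool" where
  "proper_orientation D G \<longleftrightarrow>
     orientation D G \<and>
     (\<forall>u v. (u, v) \<in> parcs G \<longrightarrow> out_degree (with_proj D) u \<noteq> out_degree (with_proj D) v)"

definition max_out_degree :: "'a pair_pre_digraph \<Rightarrow> nat" where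
  "max_out_degree D = Max (out_degree (with_proj D) ` pverts D)"

definition proper_orientation_number :: "'a pair_pre_digraph \<Rightarrow> nat" where
  "proper_orientation_number G = Min {max_out_degree D |D. proper_orientation D G}"

text \<open>
  The condition \<^term>\<open>pair_graph H\<close> is needed because the library's \<^const>\<open>subgraph\<close> relation
  is one on digraphs: it would otherwise admit non-symmetric \<open>H\<close>. \<open>Mad\<close> is only meaningful for
  graphs with at least one vertex.
\<close>

definition Mad :: "'a pair_pre_digraph \<Rightarrow> real" where
  "Mad G = Max {2 * real (card (uedges H)) / real (card (pverts H)) |H.
     pair_graph H \<and> subgraph (with_proj H) (with_proj G) \<and> pverts H \<noteq> {}}"

end

(*
Orient G with all out-degrees at most k = ceiling(Mad G / 2) and call the tail of each arc the
original owner of the edge. The potential of a vertex v is its number of out-arcs already fixed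
plus its number of undecided edges. The orientation is built from the top down: repeatedly an
independent set S receives a common value h, a vertex of S giving up its surplus of undecided
edges, but only edges originally owned by the other endpoint. A vertex of potential p therefore
always has at least p - k edges that it may give up, and the remaining vertices keep the bound k.
Always treating a vertex of maximum potential properly orients whatever is left, below the
potentials, so the only difficulty is to keep the values of the three parts apart.

With T = k + 4 the three parts are first capped at the values T, T + 2 and T + 3. Afterwards the
potentials are at most T - 1, T + 1, T + 2, and the value T has become forbidden. The value T + 1
disposes of the excess of the third part, T - 1 of its excess over T - 1 (while that of the second
part does not grow), and T - 2 of the excess of the second part. At each of these three levels S
is a maximum weight independent set of vertices of high potential. Exchange arguments show that
every high vertex outside S has enough neighbours in S, and Hall's theorem distributes the given
up edges so that enough of them still lower the potential of these vertices.
*)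
theory Submission
  imports Defs
begin

section \<open>Hall's theorem with capacities\<close>

text \<open>Halmos-Vaughan induction on the number of items. Either some nonempty proper subset is
  tight and the problem splits along it, or there is slack everywhere and one item can be placed at
  any option with positive capacity.\<close>

lemma hall_capacity:
  fixes opts :: "'i \<Rightarrow> 'v set" and cap :: "'v \<Rightarrow> nat"
  assumes "finite I" and "\<And>i. i \<in> I \<Longrightarrow> finite (opts i)"
    and "\<And>Q. Q \<subseteq> I \<Longrightarrow> card Q \<le> sum cap (\<Union>(opts ` Q))"
  shows "\<exists>g. (\<forall>i\<in>I. g i \<in> opts i) \<and> (\<forall>v. card {i \<in> I. g i = v} \<le> cap v)"
  using assms
proof (induction "card I" arbitrary: I cap rule: less_induct)
  case less
  note fin = less.prems(1) and finopts = less.prems(2) and hall = less.prems(3)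
  have finU: "finite (\<Union>(opts ` Q))" if "Q \<subseteq> I" for Q
    using that fin finopts by (meson finite_UN_I finite_subset subsetD)
  show ?case
  proof (cases "I = {}")
    case True
    then show ?thesis by auto
  next
    case False
    then obtain i where i: "i \<in> I" by blast
    show ?thesis
    proof (cases "\<exists>Q. Q \<noteq> {} \<and> Q \<subset> I \<and> card Q = sum cap (\<Union>(opts ` Q))")
      case True
      then obtain Q where Q: "Q \<noteq> {}" "Q \<subset> I" "card Q = sum cap (\<Union>(opts ` Q))" by blast
      have finQ: "finite Q" using Q fin by (meson finite_subset psubset_imp_subset)
      have "card Q < card I" using Q(2) fin by (rule psubset_card_mono[rotated])
      then have "\<exists>g. (\<forall>i\<in>Q. g i \<in> opts i) \<and> (\<forall>v. card {i \<in> Q. g i = v} \<le> cap v)"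
        using Q finQ finopts hall by (intro less.hyps) auto
      then obtain g1 where g1: "\<And>i. i \<in> Q \<Longrightarrow> g1 i \<in> opts i" "\<And>v. card {i \<in> Q. g1 i = v} \<le> cap v"
        by blast
      define N where "N = \<Union>(opts ` Q)"
      \<comment> \<open>Tightness means that \<open>Q\<close> uses up the whole capacity of
        \<open>N\<close>. Subtracting the equality for \<open>Q\<close> from Hall's inequality for
        \<open>P \<union> Q\<close> leaves Hall's condition for \<open>P\<close> with capacity zero
        on \<open>N\<close>.\<close>
      define cap2 where "cap2 v = (if v \<in> N then 0 else cap v)" for v
      have "I - Q \<subset> I" using Q by blast
      then have "card (I - Q) < card I" using fin by (intro psubset_card_mono)
      moreover have "card P \<le> sum cap2 (\<Union>(opts ` P))" if P: "P \<subseteq> I - Q" for P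
      proof -
        have finP: "finite P" using P fin by (meson finite_Diff finite_subset)
        have "card P + card Q = card (P \<union> Q)"
          using P finP finQ by (subst card_Un_disjoint) auto
        also have "\<dots> \<le> sum cap (\<Union>(opts ` (P \<union> Q)))"
          using P Q by (intro hall) auto
        also have "\<Union>(opts ` (P \<union> Q)) = N \<union> (\<Union>(opts ` P) - N)"
          by (auto simp: N_def)
        also have "sum cap \<dots> = sum cap N + sum cap (\<Union>(opts ` P) - N)"
          using finU[of Q] finU[of P] P Q by (intro sum.union_disjoint) (auto simp: N_def)
        also have "sum cap (\<Union>(opts ` P) - N) = sum cap2 (\<Union>(opts ` P))"
          using finU[of P] P
          by (intro sum.mono_neutral_cong_left) (auto simp: cap2_def)
        finally show ?thesis using Q(3) by (simp add: N_def)
      qed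
      ultimately have "\<exists>g. (\<forall>i\<in>I - Q. g i \<in> opts i) \<and> (\<forall>v. card {i \<in> I - Q. g i = v} \<le> cap2 v)"
        using fin finopts by (intro less.hyps) auto
      then obtain g2 where g2: "\<And>i. i \<in> I - Q \<Longrightarrow> g2 i \<in> opts i"
        "\<And>v. card {i \<in> I - Q. g2 i = v} \<le> cap2 v"
        by blast
      define g where "g i = (if i \<in> Q then g1 i else g2 i)" for i
      have "card {i \<in> I. g i = v} \<le> cap v" for v
      proof -
        have eq: "{i \<in> I. g i = v} = {i \<in> Q. g1 i = v} \<union> {i \<in> I - Q. g2 i = v}"
          using Q(2) by (auto simp: g_def)
        show ?thesis
        proof (cases "v \<in> N")
          case True
          then have "card {i \<in> I - Q. g2 i = v} = 0" using g2(2)[of v] by (simp add: cap2_def)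
          then have "{i \<in> I - Q. g2 i = v} = {}" using fin by auto
          then have "{i \<in> I. g i = v} = {i \<in> Q. g1 i = v}" unfolding eq by blast
          then show ?thesis using g1(2)[of v] by simp
        next
          case False
          then have "{i \<in> Q. g1 i = v} = {}" using g1(1) by (auto simp: N_def)
          then have "{i \<in> I. g i = v} = {i \<in> I - Q. g2 i = v}" unfolding eq by blast
          then show ?thesis using g2(2)[of v] False by (simp add: cap2_def)
        qed
      qed
      moreover have "\<forall>i\<in>I. g i \<in> opts i" using g1 g2 by (auto simp: g_def)
      ultimately show ?thesis by blast
    next
      case False
      then have nt: "card Q \<noteq> sum cap (\<Union>(opts ` Q))" if "Q \<noteq> {}" "Q \<subset> I" for Q
        using that by blast
      have "card {i} \<le> sum cap (opts i)" using hall[of "{i}"] i by simp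
      then obtain v where v: "v \<in> opts i" "cap v > 0"
        by (metis One_nat_def card_1_singleton_iff not_one_le_zero sum.neutral gr0I)
      \<comment> \<open>Every nonempty proper subset has slack at least one, which pays for the unit
        of capacity consumed at \<open>v\<close>.\<close>
      define cap2 where "cap2 = cap(v := cap v - 1)"
      have "card (I - {i}) < card I" using fin i by (rule card_Diff1_less)
      moreover have "card P \<le> sum cap2 (\<Union>(opts ` P))" if P: "P \<subseteq> I - {i}" for P
      proof (cases "P = {}")
        case False
        have "P \<subset> I" using P i by auto
        then have "card P < sum cap (\<Union>(opts ` P))"
          using nt False hall[of P] by (simp add: le_neq_implies_less psubset_imp_subset)
        moreover have "sum cap (\<Union>(opts ` P)) \<le> sum cap2 (\<Union>(opts ` P)) + 1"
        proof (cases "v \<in> \<Union>(opts ` P)")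
          case True
          have "sum cap (\<Union>(opts ` P)) = cap v + sum cap (\<Union>(opts ` P) - {v})"
            using True finU[of P] P by (intro sum.remove) auto
          moreover have "sum cap2 (\<Union>(opts ` P)) = cap2 v + sum cap2 (\<Union>(opts ` P) - {v})"
            using True finU[of P] P by (intro sum.remove) auto
          moreover have "sum cap2 (\<Union>(opts ` P) - {v}) = sum cap (\<Union>(opts ` P) - {v})"
            by (intro sum.cong) (auto simp: cap2_def)
          ultimately show ?thesis by (simp add: cap2_def)
        next
          case False
          then have "sum cap2 (\<Union>(opts ` P)) = sum cap (\<Union>(opts ` P))"
            by (intro sum.cong) (auto simp: cap2_def)
          then show ?thesis by simp
        qed
        ultimately show ?thesis by simp
      qed simp
      ultimately have "\<exists>g. (\<forall>j\<in>I - {i}. g j \<in> opts j) \<and> (\<forall>u. card {j \<in> I - {i}. g j = u} \<le> cap2 u)"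
        using fin finopts by (intro less.hyps) auto
      then obtain g where g: "\<And>j. j \<in> I - {i} \<Longrightarrow> g j \<in> opts j"
        "\<And>u. card {j \<in> I - {i}. g j = u} \<le> cap2 u"
        by blast
      have "card {j \<in> I. (g(i := v)) j = u} \<le> cap u" for u
      proof (cases "u = v")
        case True
        then have "{j \<in> I. (g(i := v)) j = u} = insert i {j \<in> I - {i}. g j = u}" using i by auto
        then have "card {j \<in> I. (g(i := v)) j = u} = Suc (card {j \<in> I - {i}. g j = u})"
          using fin by simp
        then show ?thesis using g(2)[of u] v True by (simp add: cap2_def)
      next
        case False
        then have "{j \<in> I. (g(i := v)) j = u} = {j \<in> I - {i}. g j = u}" by auto
        then show ?thesis using g(2)[of u] False by (simp add: cap2_def)
      qed
      moreover have "\<forall>j\<in>I. (g(i := v)) j \<in> opts j" using g(1) v by auto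
      ultimately show ?thesis by blast
    qed
  qed
qed

section \<open>Partial orientations\<close>

definition outd :: "('a \<times> 'a) set \<Rightarrow> 'a \<Rightarrow> nat" where
  "outd D v = card {u. (v, u) \<in> D}"

definition nbh :: "('a \<times> 'a) set \<Rightarrow> 'a \<Rightarrow> 'a set" where
  "nbh D v = {u. (v, u) \<in> D \<or> (u, v) \<in> D}"

definition potential :: "('a \<Rightarrow> nat) \<Rightarrow> ('a \<times> 'a) set \<Rightarrow> 'a \<Rightarrow> nat" where
  "potential w D v = w v + card (nbh D v)"

text \<open>
  Here \<open>D\<close> holds the undecided edges between the vertices of \<open>R\<close>, directed away from their original
  owners, and \<open>w v\<close> counts the arcs out of \<open>v\<close> that are already fixed.
\<close>

definition state ::
  "nat \<Rightarrow> ('a \<Rightarrow> 'c) \<Rightarrow> 'a set \<Rightarrow> ('a \<times> 'a) set \<Rightarrow> ('a \<Rightarrow> nat) \<Rightarrow> bool" where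
  "state k col R D w \<longleftrightarrow> finite R \<and> D \<subseteq> R \<times> R \<and>
     (\<forall>u v. (u, v) \<in> D \<longrightarrow> col u \<noteq> col v \<and> (v, u) \<notin> D) \<and> (\<forall>v\<in>R. w v + outd D v \<le> k)"

definition reorients :: "('a \<times> 'a) set \<Rightarrow> ('a \<times> 'a) set \<Rightarrow> bool" where
  "reorients F D \<longleftrightarrow> (\<forall>u v. (u, v) \<in> F \<longrightarrow> (v, u) \<notin> F) \<and> F \<union> F\<inverse> = D \<union> D\<inverse>"

text \<open>Properness is required along undecided edges only. Conflicts with vertices that are
  already settled are excluded separately, in \<open>solution_after_picks\<close>.\<close>

definition solution :: "'a set \<Rightarrow> ('a \<times> 'a) set \<Rightarrow> ('a \<Rightarrow> nat) \<Rightarrow> ('a \<Rightarrow> nat) \<Rightarrow> bool" where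
  "solution R D w f \<longleftrightarrow> (\<exists>F. reorients F D \<and> (\<forall>u v. (u, v) \<in> D \<longrightarrow> f u \<noteq> f v) \<and>
     (\<forall>v\<in>R. f v = w v + outd F v))"

text \<open>
  The set \<open>X s\<close> consists of the neighbours to which \<open>s\<close> gives up an edge; they are original owners.
\<close>

definition picks ::
  "('a \<times> 'a) set \<Rightarrow> ('a \<Rightarrow> nat) \<Rightarrow> nat \<Rightarrow> 'a set \<Rightarrow> ('a \<Rightarrow> 'a set) \<Rightarrow> bool" where
  "picks D w h S X \<longleftrightarrow> (\<forall>s\<in>S. \<forall>t\<in>S. (s, t) \<notin> D) \<and>
     (\<forall>s\<in>S. X s \<subseteq> {x. (x, s) \<in> D} \<and> card (X s) + h = potential w D s)"

definition remaining :: "'a set \<Rightarrow> ('a \<times> 'a) set \<Rightarrow> ('a \<times> 'a) set" where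
  "remaining S D = {(u, v) \<in> D. u \<notin> S \<and> v \<notin> S}"

text \<open>An edge that \<open>s\<close> gives up to \<open>v\<close> becomes an out-arc of
  \<open>v\<close>, so it moves from the undecided edges of \<open>v\<close> to its fixed
  arcs.\<close>

definition gain :: "('a \<Rightarrow> nat) \<Rightarrow> 'a set \<Rightarrow> ('a \<Rightarrow> 'a set) \<Rightarrow> 'a \<Rightarrow> nat" where
  "gain w S X v = w v + card {s \<in> S. v \<in> X s}"

section \<open>How settling one independent set changes potentials, states and solutions\<close>

lemma nbh_sym: "u \<in> nbh D v \<longleftrightarrow> v \<in> nbh D u"
  by (auto simp: nbh_def)

lemma state_finite_nbh: "state k col R D w \<Longrightarrow> finite (nbh D v)"
  by (rule finite_subset[of _ R]) (auto simp: state_def nbh_def)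

lemma state_nbh_col: "state k col R D w \<Longrightarrow> u \<in> nbh D v \<Longrightarrow> col u \<noteq> col v"
  unfolding state_def nbh_def mem_Collect_eq by metis

text \<open>At most \<open>k\<close> units of the potential are fixed arcs or edges owned by
  \<open>v\<close>; the others are edges owned by neighbours. This is the supply from which a
  surplus can be given up.\<close>

lemma card_in_arcs:
  assumes "state k col R D w" and "v \<in> R"
  shows "potential w D v \<le> card {x. (x, v) \<in> D} + k"
proof -
  have "nbh D v = {x. (x, v) \<in> D} \<union> {u. (v, u) \<in> D}" by (auto simp: nbh_def)
  then have "card (nbh D v) \<le> card {x. (x, v) \<in> D} + outd D v"
    unfolding outd_def by (metis card_Un_le)
  moreover have "w v + outd D v \<le> k" using assms by (simp add: state_def)
  ultimately show ?thesis by (simp add: potential_def)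
qed

lemma nbh_remaining: "v \<notin> S \<Longrightarrow> nbh (remaining S D) v = nbh D v - S"
  by (auto simp: nbh_def remaining_def)

lemma discards_subset_nbh: "picks D w h S X \<Longrightarrow> {s \<in> S. v \<in> X s} \<subseteq> nbh D v \<inter> S"
  by (auto simp: picks_def nbh_def)

text \<open>All edges between \<open>v\<close> and \<open>S\<close> become decided, and such an edge
  continues to count for \<open>v\<close> only if it was given up to \<open>v\<close>.\<close>

lemma potential_after_picks:
  assumes "state k col R D w" and "v \<notin> S"
  shows "potential (gain w S X) (remaining S D) v + card (nbh D v \<inter> S) = potential w D v + card {s \<in> S. v \<in> X s}"
proof -
  have "card (nbh D v) = card (nbh D v - S) + card (nbh D v \<inter> S)"
    using state_finite_nbh[OF assms(1), of v] card_Int_Diff[of "nbh D v" S] by simp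
  then show ?thesis using assms(2) by (simp add: potential_def gain_def nbh_remaining)
qed

lemma potential_after_picks_le:
  assumes "state k col R D w" and "picks D w h S X" and "v \<notin> S"
  shows "potential (gain w S X) (remaining S D) v \<le> potential w D v"
proof -
  have "card {s \<in> S. v \<in> X s} \<le> card (nbh D v \<inter> S)"
    using state_finite_nbh[OF assms(1)] by (intro card_mono discards_subset_nbh[OF assms(2)]) auto
  then show ?thesis using potential_after_picks[OF assms(1,3), of X] by linarith
qed

text \<open>The bound \<open>k\<close> survives because every edge received by \<open>v\<close> was
  already owned by \<open>v\<close>: it merely passes from \<open>outd\<close> to
  \<open>w\<close>.\<close>

lemma state_after_picks:
  assumes st: "state k col R D w" and S: "S \<subseteq> R" and p: "picks D w h S X"
  shows "state k col (R - S) (remaining S D) (gain w S X)"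
proof -
  have "gain w S X v + outd (remaining S D) v \<le> k" if v: "v \<in> R - S" for v
  proof -
    have fin: "finite {u. (v, u) \<in> D}"
      by (rule finite_subset[OF _ state_finite_nbh[OF st, of v]]) (auto simp: nbh_def)
    have "{s \<in> S. v \<in> X s} \<union> {u. (v, u) \<in> remaining S D} \<subseteq> {u. (v, u) \<in> D}"
      using p by (auto simp: picks_def remaining_def)
    then have "card ({s \<in> S. v \<in> X s} \<union> {u. (v, u) \<in> remaining S D}) \<le> outd D v"
      unfolding outd_def using fin by (intro card_mono)
    moreover have "card ({s \<in> S. v \<in> X s} \<union> {u. (v, u) \<in> remaining S D})
      = card {s \<in> S. v \<in> X s} + outd (remaining S D) v"
      unfolding outd_def using st S fin
      by (intro card_Un_disjoint) (auto simp: remaining_def state_def intro: finite_subset)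
    moreover have "w v + outd D v \<le> k" using st v by (simp add: state_def)
    ultimately show ?thesis by (simp add: gain_def)
  qed
  moreover have "remaining S D \<subseteq> (R - S) \<times> (R - S)"
    using st by (auto simp: state_def remaining_def)
  ultimately show ?thesis
    using st unfolding state_def by (simp add: remaining_def)
qed

text \<open>Every undecided edge at \<open>S\<close> is directed out of \<open>S\<close> unless it
  is given up in \<open>X\<close>; the cardinality condition in \<open>picks\<close> makes the final
  value exactly \<open>h\<close>. The only possible new conflict is with a later vertex adjacent to
  \<open>S\<close>, whence the last hypothesis.\<close>

lemma solution_after_picks:
  assumes st: "state k col R D w" and S: "S \<subseteq> R" and p: "picks D w h S X"
    and f: "solution (R - S) (remaining S D) (gain w S X) f"
    and ne: "\<And>v s. v \<in> R - S \<Longrightarrow> s \<in> S \<Longrightarrow> v \<in> nbh D s \<Longrightarrow> f v \<noteq> h"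
  shows "solution R D w (\<lambda>v. if v \<in> S then h else f v)"
proof -
  obtain F where F: "reorients F (remaining S D)" "\<And>u v. (u, v) \<in> remaining S D \<Longrightarrow> f u \<noteq> f v"
    "\<And>v. v \<in> R - S \<Longrightarrow> f v = gain w S X v + outd F v"
    using f unfolding solution_def by blast
  have asym: "(v, u) \<notin> D" if "(u, v) \<in> D" for u v using st that by (auto simp: state_def)
  have DR: "D \<subseteq> R \<times> R" using st by (auto simp: state_def)
  have FS: "u \<notin> S \<and> v \<notin> S \<and> v \<in> nbh D u" if "(u, v) \<in> F" for u v
  proof -
    have "(u, v) \<in> remaining S D \<union> (remaining S D)\<inverse>" using F(1) that unfolding reorients_def by blast
    then show ?thesis by (auto simp: remaining_def nbh_def)
  qed
  have XD: "(x, s) \<in> D" if "s \<in> S" "x \<in> X s" for x s using p that by (auto simp: picks_def)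
  have indep: "(s, t) \<notin> D" if "s \<in> S" "t \<in> S" for s t using p that by (auto simp: picks_def)
  define F' where "F' = F \<union> {(x, s). s \<in> S \<and> x \<in> X s} \<union> {(s, x). s \<in> S \<and> x \<in> nbh D s - X s}"
  have F'_iff: "(u, v) \<in> F' \<longleftrightarrow>
      (u, v) \<in> F \<or> v \<in> S \<and> u \<in> X v \<or> u \<in> S \<and> v \<in> nbh D u \<and> v \<notin> X u" for u v
    by (auto simp: F'_def)
  have nbh_iff: "v \<in> nbh D u \<longleftrightarrow> (u, v) \<in> D \<or> (v, u) \<in> D" for u v
    by (auto simp: nbh_def)
  have "reorients F' D"
  proof -
    have 1: "(v, u) \<notin> F'" if "(u, v) \<in> F'" for u v
    proof (cases "(u, v) \<in> F")
      case True
      then have "(v, u) \<notin> F" using F(1) by (simp add: reorients_def)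
      then show ?thesis using FS[OF True] by (simp add: F'_iff)
    next
      case False
      then have "(v \<in> S \<and> u \<in> X v \<and> u \<notin> S) \<or> (u \<in> S \<and> v \<in> nbh D u \<and> v \<notin> X u \<and> v \<notin> S)"
        using that XD indep unfolding F'_iff nbh_iff by blast
      then show ?thesis using FS[of v u] unfolding F'_iff by blast
    qed
    have "(u, v) \<in> D \<or> (v, u) \<in> D" if "(u, v) \<in> F'" for u v
      using that FS[of u v] XD[of v u] unfolding F'_iff nbh_iff by blast
    then have "F' \<union> F'\<inverse> \<subseteq> D \<union> D\<inverse>" by auto
    moreover have "(u, v) \<in> F' \<union> F'\<inverse>" if uv: "(u, v) \<in> D" for u v
    proof (cases "u \<in> S \<or> v \<in> S")
      case True
      then show ?thesis using uv unfolding Un_iff converse_iff F'_iff nbh_iff by blast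
    next
      case False
      then have "(u, v) \<in> remaining S D" using uv by (simp add: remaining_def)
      then have "(u, v) \<in> F \<union> F\<inverse>" using F(1) unfolding reorients_def by blast
      then show ?thesis unfolding F'_def by blast
    qed
    then have "D \<union> D\<inverse> \<subseteq> F' \<union> F'\<inverse>" by auto
    ultimately show ?thesis using 1 unfolding reorients_def by blast
  qed
  moreover have "(if u \<in> S then h else f u) \<noteq> (if v \<in> S then h else f v)" if uv: "(u, v) \<in> D" for u v
  proof -
    have "u \<in> R" "v \<in> R" "v \<in> nbh D u" "u \<in> nbh D v" using uv DR by (auto simp: nbh_def)
    then show ?thesis
      using ne[of u v] ne[of v u] F(2)[of u v] uv indep[of u v] by (auto simp: remaining_def)
  qed
  moreover have "(if v \<in> S then h else f v) = w v + outd F' v" if v: "v \<in> R" for v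
  proof (cases "v \<in> S")
    case True
    have "{u. (v, u) \<in> F'} = nbh D v - X v"
      using True FS[of v] XD[of _ v] indep unfolding F'_iff nbh_iff by (auto simp: nbh_def)
    moreover have "X v \<subseteq> nbh D v" using XD True by (auto simp: nbh_def)
    moreover have "card (X v) + h = w v + card (nbh D v)" using p True by (simp add: picks_def potential_def)
    moreover have "card (nbh D v - X v) + card (X v) = card (nbh D v)"
      using calculation(2) state_finite_nbh[OF st, of v] card_Int_Diff[of "nbh D v" "X v"]
      by (simp add: Int_absorb1)
    ultimately show ?thesis using True unfolding outd_def by simp
  next
    case False
    have "{u. (v, u) \<in> F'} = {u. (v, u) \<in> F} \<union> {s \<in> S. v \<in> X s}"
      using False unfolding F'_iff by auto
    moreover have "finite {u. (v, u) \<in> F}"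
      by (rule finite_subset[OF _ state_finite_nbh[OF st, of v]]) (use FS in blast)
    moreover have "finite {s \<in> S. v \<in> X s}" using st S by (auto simp: state_def intro: finite_subset)
    moreover have "{u. (v, u) \<in> F} \<inter> {s \<in> S. v \<in> X s} = {}" using FS by blast
    ultimately have "outd F' v = outd F v + card {s \<in> S. v \<in> X s}"
      unfolding outd_def by (simp add: card_Un_disjoint)
    then show ?thesis using F(3)[of v] v False by (simp add: gain_def)
  qed
  ultimately show ?thesis unfolding solution_def by blast
qed

text \<open>If a vertex of maximum potential keeps all its undecided edges as out-arcs, each
  neighbour loses one unit and therefore ends strictly below that maximum.\<close>

lemma greedy:
  assumes "state k col R D w"
  shows "\<exists>f. solution R D w f \<and> (\<forall>v\<in>R. f v \<le> potential w D v)"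
  using assms
proof (induction "card R" arbitrary: R D w)
  case 0
  then have "R = {}" "D = {}" by (auto simp: state_def)
  then show ?case by (auto simp: solution_def reorients_def)
next
  case (Suc n)
  have fin: "finite R" "R \<noteq> {}" using Suc by (auto simp: state_def)
  then have "Max (potential w D ` R) \<in> potential w D ` R" by (intro Max_in) auto
  then obtain s where "s \<in> R" "potential w D s = Max (potential w D ` R)" by auto
  then have s: "s \<in> R" "\<And>v. v \<in> R \<Longrightarrow> potential w D v \<le> potential w D s" using fin by auto
  have p: "picks D w (potential w D s) {s} (\<lambda>_. {})"
    using Suc.prems by (auto simp: picks_def state_def)
  have st: "state k col (R - {s}) (remaining {s} D) (gain w {s} (\<lambda>_. {}))"
    using state_after_picks[OF Suc.prems _ p] s by simp
  have "card (R - {s}) = n" using Suc.hyps(2) s fin by simp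
  then obtain f where f: "solution (R - {s}) (remaining {s} D) (gain w {s} (\<lambda>_. {})) f"
    "\<And>v. v \<in> R - {s} \<Longrightarrow> f v \<le> potential (gain w {s} (\<lambda>_. {})) (remaining {s} D) v"
    using Suc.hyps(1)[OF _ st] by blast
  have le: "f v + card (nbh D v \<inter> {s}) \<le> potential w D v" if "v \<in> R - {s}" for v
    using f(2)[OF that] potential_after_picks[OF Suc.prems, of v "{s}" "\<lambda>_. {}"] that by simp
  have "f v \<noteq> potential w D s" if "v \<in> R - {s}" "v \<in> nbh D s" for v
  proof -
    have "nbh D v \<inter> {s} = {s}" using that by (auto simp: nbh_sym)
    then show ?thesis using le[OF that(1)] s(2)[of v] that(1) by simp
  qed
  then have "solution R D w (\<lambda>v. if v \<in> {s} then potential w D s else f v)"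
    using s by (intro solution_after_picks[OF Suc.prems _ p f(1)]) auto
  moreover have "(if v \<in> {s} then potential w D s else f v) \<le> potential w D v" if "v \<in> R" for v
    using le[of v] that by auto
  ultimately show ?case by blast
qed

section \<open>Distributing the surplus edges\<close>

lemma sum_card_nbh_swap:
  assumes "finite S" and "finite W"
  shows "(\<Sum>v\<in>W. card (nbh D v \<inter> S)) = (\<Sum>s\<in>S. card (nbh D s \<inter> W))"
proof -
  have "(\<Sum>v\<in>W. card (nbh D v \<inter> S)) = (\<Sum>v\<in>W. \<Sum>s\<in>S. if s \<in> nbh D v then 1 else 0)"
    using assms by (intro sum.cong) (auto simp: Int_commute sum.If_cases)
  also have "\<dots> = (\<Sum>s\<in>S. \<Sum>v\<in>W. if v \<in> nbh D s then 1 else 0)"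
    by (subst sum.swap) (simp add: nbh_sym)
  also have "\<dots> = (\<Sum>s\<in>S. card (nbh D s \<inter> W))"
    using assms by (intro sum.cong) (auto simp: Int_commute sum.If_cases)
  finally show ?thesis .
qed

text \<open>
  The number \<open>need v\<close> is the amount by which the potential of \<open>v\<close> has to drop.
\<close>

lemma discard_choice:
  assumes st: "state k col R D w" and S: "S \<subseteq> R" and indep: "\<And>s t. s \<in> S \<Longrightarrow> t \<in> S \<Longrightarrow> (s, t) \<notin> D"
    and potential: "\<And>s. s \<in> S \<Longrightarrow> potential w D s = h \<or> potential w D s = Suc h"
    and k: "k + t \<le> h"
    and T: "T \<subseteq> R - S" and need: "\<And>v. v \<in> T \<Longrightarrow> need v \<le> card (nbh D v \<inter> S)"
    and cond: "\<And>W. W \<subseteq> T \<Longrightarrow> sum need W \<le> (\<Sum>s\<in>S. min t (card (nbh D s \<inter> W)))"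
  shows "\<exists>X. picks D w h S X \<and> (\<forall>s\<in>S. X s \<noteq> {} \<longrightarrow> potential w D s = Suc h) \<and>
    (\<forall>v\<in>T. card {s \<in> S. v \<in> X s} + need v \<le> card (nbh D v \<inter> S))"
proof -
  \<comment> \<open>Only vertices of potential \<open>Suc h\<close> have a surplus, and it is a
    single edge. Hall's theorem selects, for each of them, the owner that receives it.\<close>
  define Y where "Y = {s \<in> S. potential w D s = Suc h}"
  define opts where "opts s = {x. (x, s) \<in> D}" for s
  \<comment> \<open>A vertex of \<open>T\<close> may receive only as many edges as its need permits.
    Outside \<open>T\<close> the capacity \<open>card Y\<close> amounts to no restriction.\<close>
  define cap where "cap v = (if v \<in> T then card (nbh D v \<inter> S) - need v else card Y)" for v
  have finR: "finite R" using st by (simp add: state_def)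
  then have finS: "finite S" and finY: "finite Y" and finT: "finite T"
    using S T by (auto simp: Y_def intro: finite_subset)
  have opts_nbh: "opts s \<subseteq> nbh D s" for s by (auto simp: opts_def nbh_def)
  then have finopts: "finite (opts s)" for s using state_finite_nbh[OF st] finite_subset by blast
  \<comment> \<open>Since \<open>Suc h - k\<close> exceeds \<open>t\<close>, ownership provides more
    than \<open>t\<close> possible receivers.\<close>
  have big: "t + 1 \<le> card (opts s)" if "s \<in> Y" for s
    using card_in_arcs[OF st, of s] that S k unfolding Y_def opts_def by auto
  have "card Q \<le> sum cap (\<Union>(opts ` Q))" if Q: "Q \<subseteq> Y" for Q
  proof -
    define W where "W = \<Union>(opts ` Q)"
    have finQ: "finite Q" using Q finY by (rule finite_subset)
    have finW: "finite W" using finQ finopts by (auto simp: W_def)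
    show ?thesis
    proof (cases "W \<subseteq> T")
      case True
      have SQ: "S \<inter> {s. s \<in> Q} = Q" using Q by (auto simp: Y_def)
      \<comment> \<open>If \<open>s \<in> Q\<close>, all its options lie in \<open>W\<close>, so
        truncation at \<open>t\<close> loses at least one edge. These losses together pay for
        \<open>card Q\<close>.\<close>
      have *: "min t (card (nbh D s \<inter> W)) + (if s \<in> Q then 1 else 0) \<le> card (nbh D s \<inter> W)"
        if "s \<in> S" for s
      proof (cases "s \<in> Q")
        case True
        then have "opts s \<subseteq> nbh D s \<inter> W" using opts_nbh by (auto simp: W_def)
        then have "card (opts s) \<le> card (nbh D s \<inter> W)" using finW by (intro card_mono) auto
        then show ?thesis using big[of s] True Q by auto
      qed simp
      have "sum need W + card Q
        \<le> (\<Sum>s\<in>S. min t (card (nbh D s \<inter> W))) + (\<Sum>s\<in>S. if s \<in> Q then 1 else 0)"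
        using cond[OF True] finS SQ by (simp add: sum.If_cases)
      also have "\<dots> \<le> (\<Sum>s\<in>S. card (nbh D s \<inter> W))"
        using * by (simp add: sum_mono flip: sum.distrib)
      also have "\<dots> = (\<Sum>v\<in>W. card (nbh D v \<inter> S))"
        using finS finW by (simp add: sum_card_nbh_swap)
      also have "\<dots> = sum cap W + sum need W"
        unfolding sum.distrib[symmetric] using True need by (intro sum.cong) (auto simp: cap_def)
      finally show ?thesis by (simp add: W_def)
    next
      case False
      \<comment> \<open>One receiver outside \<open>T\<close> already has room for all of
        \<open>Y\<close>.\<close>
      then obtain v where "v \<in> W" "v \<notin> T" by auto
      then have "card Y \<le> sum cap W"
        using finW member_le_sum[of v W cap] by (simp add: cap_def)
      then show ?thesis using card_mono[OF finY Q] by (simp add: W_def)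
    qed
  qed
  then obtain g where g: "\<And>s. s \<in> Y \<Longrightarrow> g s \<in> opts s" "\<And>v. card {s \<in> Y. g s = v} \<le> cap v"
    using hall_capacity[of Y opts cap, OF finY finopts] by blast
  define X where "X s = (if s \<in> Y then {g s} else {})" for s
  have "{s \<in> S. v \<in> X s} = {s \<in> Y. g s = v}" for v by (auto simp: X_def Y_def)
  then have "card {s \<in> S. v \<in> X s} + need v \<le> card (nbh D v \<inter> S)" if "v \<in> T" for v
    using g(2)[of v] need[OF that] that by (simp add: cap_def)
  moreover have "picks D w h S X"
    using indep potential g(1) by (auto simp: picks_def X_def Y_def opts_def)
  ultimately show ?thesis by (intro exI[of _ X]) (auto simp: X_def Y_def)
qed

text \<open>Exchanging the members of \<open>S\<close> adjacent to a monochromatic set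
  \<open>W\<close> for \<open>W\<close> itself keeps the set independent, since a colour class spans
  no edge. Maximality of the weight then gives the inequality.\<close>

lemma max_weight_independent:
  fixes wt :: "'a \<Rightarrow> nat"
  assumes st: "state k col R D w" and E: "E \<subseteq> R"
  shows "\<exists>S. S \<subseteq> E \<and> (\<forall>s\<in>S. \<forall>t\<in>S. (s, t) \<notin> D) \<and>
    (\<forall>W. W \<subseteq> E - S \<longrightarrow> (\<forall>u\<in>W. \<forall>v\<in>W. col u = col v) \<longrightarrow>
      sum wt W \<le> sum wt {s \<in> S. nbh D s \<inter> W \<noteq> {}})"
proof -
  have finE: "finite E" using st E by (auto simp: state_def intro: finite_subset)
  define I where "I = {S. S \<subseteq> E \<and> (\<forall>s\<in>S. \<forall>t\<in>S. (s, t) \<notin> D)}"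
  have finI: "finite I" using finE by (auto simp: I_def)
  have "{} \<in> I" by (simp add: I_def)
  then have "Max (sum wt ` I) \<in> sum wt ` I" using finI by (intro Max_in) auto
  then obtain S where S: "S \<in> I" "sum wt S = Max (sum wt ` I)" by auto
  have max: "sum wt S' \<le> sum wt S" if "S' \<in> I" for S'
    unfolding S(2) using that finI by (intro Max_ge) auto
  have exchange: "sum wt W \<le> sum wt {s \<in> S. nbh D s \<inter> W \<noteq> {}}"
    if W: "W \<subseteq> E - S" "\<forall>u\<in>W. \<forall>v\<in>W. col u = col v" for W
  proof -
    define N where "N = {s \<in> S. nbh D s \<inter> W \<noteq> {}}"
    have fin: "finite S" "finite W" using S W(1) finE by (auto simp: I_def intro: finite_subset)
    have WW: "(u, v) \<notin> D" if "u \<in> W" "v \<in> W" for u v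
    proof
      assume "(u, v) \<in> D"
      then have "col u \<noteq> col v" using st by (simp add: state_def)
      then show False using W(2) that by blast
    qed
    have SS: "(u, v) \<notin> D" if "u \<in> S" "v \<in> S" for u v
      using S(1) that unfolding I_def by blast
    have SW: "(u, v) \<notin> D \<and> (v, u) \<notin> D" if "u \<in> S - N" "v \<in> W" for u v
      using that unfolding N_def nbh_def by blast
    have "(u, v) \<notin> D" if "u \<in> (S - N) \<union> W" "v \<in> (S - N) \<union> W" for u v
      using that WW[of u v] SS[of u v] SW[of u v] SW[of v u] by blast
    moreover have "(S - N) \<union> W \<subseteq> E" using S(1) W(1) unfolding I_def by blast
    ultimately have "(S - N) \<union> W \<in> I" unfolding I_def by blast
    then have "sum wt ((S - N) \<union> W) \<le> sum wt S" by (rule max)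
    moreover have "sum wt ((S - N) \<union> W) = sum wt (S - N) + sum wt W"
      using fin W(1) by (intro sum.union_disjoint) auto
    moreover have "sum wt S = sum wt (S - N) + sum wt N"
      using fin by (intro sum.subset_diff) (auto simp: N_def)
    ultimately show ?thesis by (simp add: N_def)
  qed
  have "S \<subseteq> E" "\<forall>s\<in>S. \<forall>t\<in>S. (s, t) \<notin> D"
    using S(1) unfolding I_def by blast+
  then show ?thesis by (intro exI[of _ S] conjI allI impI exchange)
qed

section \<open>One part with excess\<close>

text \<open>Vertices of \<open>E - S\<close> outside colour \<open>c\<close> must lose one unit.
  Exchange yields Hall's condition for each of their two colours, and adding the two accounts for
  the truncation at 2 and for \<open>k + 2 \<le> h\<close>. A neighbour in \<open>S\<close> of a
  vertex of colour \<open>c\<close> has no surplus to give up, so every edge to \<open>S\<close>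
  lowers the latter.\<close>

lemma single_step:
  fixes col :: "'a \<Rightarrow> 'c"
  assumes st: "state k col R D w" and k: "k + 2 \<le> h"
    and cols: "\<And>v. v \<in> R \<Longrightarrow> col v \<in> {a, b, c}" "a \<noteq> b"
    and low: "\<And>v. v \<in> R \<Longrightarrow> col v \<noteq> c \<Longrightarrow> potential w D v \<le> h"
    and high: "\<And>v. v \<in> R \<Longrightarrow> potential w D v \<le> Suc h"
  shows "\<exists>S X. S \<subseteq> R \<and> picks D w h S X \<and> (\<forall>v\<in>R - S. potential (gain w S X) (remaining S D) v < h)"
proof -
  define E where "E = {v \<in> R. h \<le> potential w D v}"
  define n where "n = card R"
  \<comment> \<open>so \<open>S\<close> has maximum cardinality and, subject to that, contains as many vertices with excess
    as possible\<close>
  define wt where "wt v = Suc n + (if potential w D v = Suc h then 1 else 0)" for v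
  have ER: "E \<subseteq> R" by (auto simp: E_def)
  obtain S where SE: "S \<subseteq> E" and S: "\<forall>s\<in>S. \<forall>t\<in>S. (s, t) \<notin> D"
    "\<forall>W. W \<subseteq> E - S \<longrightarrow> (\<forall>u\<in>W. \<forall>v\<in>W. col u = col v) \<longrightarrow>
      sum wt W \<le> sum wt {s \<in> S. nbh D s \<inter> W \<noteq> {}}"
    using max_weight_independent[OF st ER, of wt] by (elim exE conjE) (rule that; assumption)
  note indep = S(1)[rule_format] and max = S(2)[rule_format]
  have finR: "finite R" using st by (simp add: state_def)
  have SR: "S \<subseteq> R" and finS: "finite S"
    using SE finR by (auto simp: E_def intro: finite_subset)
  \<comment> \<open>On a subset of \<open>S\<close> the bonus units in \<open>wt\<close> total at
    most \<open>n\<close>, less than one base weight \<open>Suc n\<close>. Hence comparing weights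
    suffices to compare cardinalities.\<close>
  have card_le: "card W \<le> card {s \<in> S. nbh D s \<inter> W \<noteq> {}}"
    if W: "W \<subseteq> E - S" "\<forall>u\<in>W. \<forall>v\<in>W. col u = col v" for W
  proof (rule ccontr)
    define N where "N = {s \<in> S. nbh D s \<inter> W \<noteq> {}}"
    assume "\<not> ?thesis"
    then have "card N + 1 \<le> card W" by (simp add: N_def)
    then have "(card N + 1) * Suc n \<le> card W * Suc n" by (rule mult_le_mono1)
    also have "\<dots> \<le> sum wt W" using sum_bounded_below[of W "Suc n" wt] by (simp add: wt_def)
    also have "\<dots> \<le> sum wt N" unfolding N_def by (rule max[OF W(1)]) (use W(2) in blast)
    also have "\<dots> \<le> card N * Suc (Suc n)"
      using sum_bounded_above[of N wt "Suc (Suc n)"] by (simp add: wt_def)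
    finally have "Suc n \<le> card N" by (simp add: algebra_simps)
    moreover have "card N \<le> n"
      unfolding n_def using SR finR by (intro card_mono) (auto simp: N_def)
    ultimately show False by simp
  qed
  have N1: "{s \<in> S. nbh D s \<inter> {v} \<noteq> {}} = nbh D v \<inter> S" for v by (auto simp: nbh_def)
  define T where "T = {v \<in> E - S. col v \<noteq> c}"
  have "\<exists>X. picks D w h S X \<and> (\<forall>s\<in>S. X s \<noteq> {} \<longrightarrow> potential w D s = Suc h) \<and>
    (\<forall>v\<in>T. card {s \<in> S. v \<in> X s} + 1 \<le> card (nbh D v \<inter> S))"
  proof (rule discard_choice[OF st SR indep _ k])
    show "potential w D s = h \<or> potential w D s = Suc h" if "s \<in> S" for s
      using that SE high[of s] by (auto simp: E_def)
    show "T \<subseteq> R - S" by (auto simp: T_def E_def)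
    show "1 \<le> card (nbh D v \<inter> S)" if "v \<in> T" for v
      using card_le[of "{v}"] that unfolding N1 by (simp add: T_def)
    fix W assume W: "W \<subseteq> T"
    have finW: "finite W" using W finR by (auto simp: T_def E_def intro: finite_subset)
    define P where "P d = {v \<in> W. col v = d}" for d
    have WP: "W = P a \<union> P b" and disj: "P a \<inter> P b = {}"
      using W cols by (auto simp: P_def T_def E_def)
    have "card W = card (P a) + card (P b)"
      unfolding WP using finW disj by (intro card_Un_disjoint) (auto simp: P_def)
    also have "\<dots> \<le> card {s \<in> S. nbh D s \<inter> P a \<noteq> {}} + card {s \<in> S. nbh D s \<inter> P b \<noteq> {}}"
      using W by (intro add_mono card_le) (auto simp: P_def T_def)
    also have "\<dots> = (\<Sum>s\<in>S. (if nbh D s \<inter> P a \<noteq> {} then 1 else 0) +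
        (if nbh D s \<inter> P b \<noteq> {} then 1 else 0))"
      using finS by (simp add: sum.distrib sum.If_cases Int_def conj_commute)
    also have "\<dots> \<le> (\<Sum>s\<in>S. min 2 (card (nbh D s \<inter> W)))"
    proof (rule sum_mono)
      fix s
      have "card (nbh D s \<inter> W) = card (nbh D s \<inter> P a) + card (nbh D s \<inter> P b)"
        unfolding WP Int_Un_distrib using finW disj
        by (intro card_Un_disjoint) (auto simp: P_def)
      moreover have "(if nbh D s \<inter> P d \<noteq> {} then 1 else 0) \<le> card (nbh D s \<inter> P d)" for d
        using finW by (auto simp: P_def Suc_le_eq card_gt_0_iff)
      from add_mono[OF this[of a] this[of b]]
      have "(if nbh D s \<inter> P a \<noteq> {} then 1 else 0) + (if nbh D s \<inter> P b \<noteq> {} then 1 else 0)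
          \<le> card (nbh D s \<inter> P a) + card (nbh D s \<inter> P b)" .
      ultimately show "(if nbh D s \<inter> P a \<noteq> {} then 1 else 0) + (if nbh D s \<inter> P b \<noteq> {} then 1 else 0)
          \<le> min 2 (card (nbh D s \<inter> W))"
        by simp
    qed
    finally show "(\<Sum>v\<in>W. 1) \<le> (\<Sum>s\<in>S. min 2 (card (nbh D s \<inter> W)))" by simp
  qed
  then obtain X where X: "picks D w h S X" "\<And>s. s \<in> S \<Longrightarrow> X s \<noteq> {} \<Longrightarrow> potential w D s = Suc h"
    "\<And>v. v \<in> T \<Longrightarrow> card {s \<in> S. v \<in> X s} + 1 \<le> card (nbh D v \<inter> S)"
    by blast
  have "potential (gain w S X) (remaining S D) v < h" if v: "v \<in> R - S" for v
  proof -
    have eq: "potential (gain w S X) (remaining S D) v + card (nbh D v \<inter> S) = potential w D v + card {s \<in> S. v \<in> X s}"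
      using potential_after_picks[OF st] v by simp
    show ?thesis
    proof (cases "h \<le> potential w D v")
      case False
      then show ?thesis using potential_after_picks_le[OF st X(1), of v] v by simp
    next
      case True
      then have vE: "v \<in> E - S" using v by (simp add: E_def)
      show ?thesis
      proof (cases "col v = c")
        case False
        then have "v \<in> T" using vE by (simp add: T_def)
        then show ?thesis using eq X(3)[of v] low[of v] False v by simp
      next
        case col: True
        have nocol: "col s \<noteq> c" if "s \<in> nbh D v" for s using state_nbh_col[OF st that] col by simp
        have empty: "{s \<in> S. v \<in> X s} = {}"
        proof (rule ccontr)
          assume "{s \<in> S. v \<in> X s} \<noteq> {}"
          then obtain s where s: "s \<in> S" "v \<in> X s" by blast
          then have "potential w D s = Suc h" using X(2) by blast
          moreover have "s \<in> nbh D v" using discards_subset_nbh[OF X(1), of v] s by blast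
          ultimately show False using low[of s] nocol[of s] s SR by auto
        qed
        then have eq': "potential (gain w S X) (remaining S D) v + card (nbh D v \<inter> S) = potential w D v"
          using eq unfolding empty by simp
        have wtN: "sum wt {v} \<le> sum wt (nbh D v \<inter> S)"
          using max[of "{v}"] vE unfolding N1 by simp
        have "sum wt (nbh D v \<inter> S) \<le> card (nbh D v \<inter> S) * Suc n"
        proof -
          have "wt s \<le> Suc n" if "s \<in> nbh D v \<inter> S" for s
            using that low[of s] nocol[of s] SR by (auto simp: wt_def)
          then show ?thesis using sum_bounded_above[of "nbh D v \<inter> S" wt "Suc n"] by simp
        qed
        then have le: "wt v \<le> card (nbh D v \<inter> S) * Suc n" using wtN by simp
        have "0 < wt v" by (simp add: wt_def)
        then have "card (nbh D v \<inter> S) \<noteq> 0" using le by (intro notI) simp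
        \<comment> \<open>One neighbour of weight at most \<open>Suc n\<close> cannot balance the
          weight \<open>Suc (Suc n)\<close> of a vertex with excess. Such a vertex has two
          neighbours in \<open>S\<close> and thus falls below \<open>h\<close>.\<close>
        moreover have "card (nbh D v \<inter> S) \<noteq> 1" if "potential w D v = Suc h"
          using le that by (auto simp: wt_def)
        ultimately show ?thesis using eq' high[of v] v by (cases "potential w D v = Suc h") auto
      qed
    qed
  qed
  then show ?thesis using X(1) SR by blast
qed

section \<open>Two parts with excess\<close>

text \<open>Colour \<open>b\<close> only has to come down to \<open>h\<close>, so \<open>E\<close>
  omits its vertices of potential \<open>h\<close>. Colour \<open>c\<close> has to go below
  \<open>h\<close> and may need two units, hence the larger weight. The demands of the colours are
  met separately and then fitted into three units per vertex of \<open>S\<close>, matching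
  \<open>k + 3 \<le> h\<close>.\<close>

lemma double_step:
  fixes col :: "'a \<Rightarrow> 'c"
  assumes st: "state k col R D w" and k: "k + 3 \<le> h"
    and cols: "\<And>v. v \<in> R \<Longrightarrow> col v \<in> {a, b, c}" "a \<noteq> b" "a \<noteq> c" "b \<noteq> c"
    and low: "\<And>v. v \<in> R \<Longrightarrow> col v = a \<Longrightarrow> potential w D v \<le> h"
    and high: "\<And>v. v \<in> R \<Longrightarrow> potential w D v \<le> Suc h"
  shows "\<exists>S X. S \<subseteq> R \<and> picks D w h S X \<and> (\<forall>v\<in>R - S. potential (gain w S X) (remaining S D) v \<le> h \<and>
    (col v \<noteq> b \<longrightarrow> potential (gain w S X) (remaining S D) v < h))"
proof -
  define E where "E = {v \<in> R. potential w D v = Suc h \<or> potential w D v = h \<and> col v \<noteq> b}"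
  define wt :: "'a \<Rightarrow> nat" where "wt v = (if potential w D v = Suc h \<and> col v = c then 3 else 2)" for v
  have wt_ge: "2 \<le> wt v" for v by (simp add: wt_def)
  define need where "need v = (if col v = c then wt v - 1 else 1)" for v
  have need_le: "need v \<le> 2" for v by (simp add: need_def wt_def)
  have ER: "E \<subseteq> R" by (auto simp: E_def)
  obtain S where SE: "S \<subseteq> E" and S: "\<forall>s\<in>S. \<forall>t\<in>S. (s, t) \<notin> D"
    "\<forall>W. W \<subseteq> E - S \<longrightarrow> (\<forall>u\<in>W. \<forall>v\<in>W. col u = col v) \<longrightarrow>
      sum wt W \<le> sum wt {s \<in> S. nbh D s \<inter> W \<noteq> {}}"
    using max_weight_independent[OF st ER, of wt] by (elim exE conjE) (rule that; assumption)
  note indep = S(1)[rule_format] and max = S(2)[rule_format]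
  have finR: "finite R" using st by (simp add: state_def)
  have SR: "S \<subseteq> R" and finS: "finite S" and finE: "finite E"
    using SE ER finR by (auto intro: finite_subset)
  have N1: "{s \<in> S. nbh D s \<inter> {v} \<noteq> {}} = nbh D v \<inter> S" for v by (auto simp: nbh_def)
  \<comment> \<open>a vertex of colour \<open>c\<close> may have to lower vertices of both other parts; half of its three
    units is reserved for either of them, and \<open>\<psi>\<close> counts half units\<close>
  define \<psi> where "\<psi> s x = min (if col s = c then 3 else 2) (2 * x)" for s and x :: nat
  have mono: "card (nbh D s \<inter> (W - {v})) \<le> card (nbh D s \<inter> W)" if "finite W" for s v W
    using that by (intro card_mono) auto
  have remove: "card (nbh D s \<inter> (W - {v})) = 0"
    if v: "v \<in> W" "s \<in> nbh D v" and one: "card (nbh D s \<inter> W) = 1" for s v W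
  proof -
    obtain x where x: "nbh D s \<inter> W = {x}" using one by (rule card_1_singletonE)
    have "v \<in> nbh D s \<inter> W" using v by (simp add: nbh_sym)
    then have "nbh D s \<inter> W - {v} = {}" unfolding x by simp
    moreover have "nbh D s \<inter> (W - {v}) = nbh D s \<inter> W - {v}" by blast
    ultimately have "nbh D s \<inter> (W - {v}) = {}" by simp
    then show ?thesis by simp
  qed
  have claim: "2 * card W \<le> (\<Sum>s\<in>S. \<psi> s (card (nbh D s \<inter> W)))"
    if "W \<subseteq> E - S" "d \<noteq> c" "\<And>v. v \<in> W \<Longrightarrow> col v = d" for W d
    using that
  proof (induction "card W" arbitrary: W rule: less_induct)
    case (less W)
    have finW: "finite W" using less.prems(1) finE by (auto intro: finite_subset)
    show ?case
    \<comment> \<open>If \<open>v\<close> is the only neighbour of some \<open>s\<close> in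
      \<open>W\<close>, removing \<open>v\<close> frees 2 half units at \<open>s\<close>. Otherwise
      every \<open>s\<close> meeting \<open>W\<close> has two neighbours there and contributes at
      least \<open>wt s\<close>, so the exchange inequality suffices.\<close>
    proof (cases "\<exists>v\<in>W. \<exists>s\<in>S. s \<in> nbh D v \<and> card (nbh D s \<inter> W) = 1")
      case True
      then obtain v s where vs: "v \<in> W" "s \<in> S" "s \<in> nbh D v" "card (nbh D s \<inter> W) = 1" by blast
      have "2 * card (W - {v}) \<le> (\<Sum>s\<in>S. \<psi> s (card (nbh D s \<inter> (W - {v}))))"
        using less.prems by (intro less.hyps card_Diff1_less[OF finW vs(1)]) auto
      then have "2 * card W \<le> (\<Sum>t\<in>S. \<psi> t (card (nbh D t \<inter> (W - {v})))) + (\<Sum>t\<in>S. if t = s then 2 else 0)"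
        using vs(2) finS card_Suc_Diff1[OF finW vs(1)] by simp
      also have "\<dots> = (\<Sum>t\<in>S. \<psi> t (card (nbh D t \<inter> (W - {v}))) + (if t = s then 2 else 0))"
        by (simp add: sum.distrib)
      also have "\<dots> \<le> (\<Sum>t\<in>S. \<psi> t (card (nbh D t \<inter> W)))"
      proof (rule sum_mono)
        fix t
        show "\<psi> t (card (nbh D t \<inter> (W - {v}))) + (if t = s then 2 else 0) \<le> \<psi> t (card (nbh D t \<inter> W))"
          using remove[OF vs(1,3,4)] vs(4) mono[OF finW, of t v] by (auto simp: \<psi>_def)
      qed
      finally show ?thesis .
    next
      case False
      define N where "N = {s \<in> S. nbh D s \<inter> W \<noteq> {}}"
      have "2 * card W \<le> sum wt W" using sum_bounded_below[of W 2 wt] wt_ge by (simp add: mult.commute)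
      also have "\<dots> \<le> sum wt N"
        unfolding N_def by (rule max[OF less.prems(1)]) (use less.prems(3) in metis)
      also have "\<dots> \<le> (\<Sum>s\<in>N. \<psi> s (card (nbh D s \<inter> W)))"
      proof (rule sum_mono)
        fix s assume s: "s \<in> N"
        then have "card (nbh D s \<inter> W) \<noteq> 0" using finW by (simp add: N_def)
        moreover have "card (nbh D s \<inter> W) \<noteq> 1"
        proof
          assume 1: "card (nbh D s \<inter> W) = 1"
          obtain v where "v \<in> nbh D s \<inter> W" using s by (auto simp: N_def)
          then show False using False 1 s by (auto simp: N_def nbh_sym)
        qed
        ultimately have "2 \<le> card (nbh D s \<inter> W)" by linarith
        then show "wt s \<le> \<psi> s (card (nbh D s \<inter> W))" by (auto simp: wt_def \<psi>_def)
      qed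
      also have "\<dots> \<le> (\<Sum>s\<in>S. \<psi> s (card (nbh D s \<inter> W)))"
        using finS by (intro sum_mono2) (auto simp: N_def)
      finally show ?thesis .
    qed
  qed
  \<comment> \<open>in a minimal counterexample every vertex has fewer private neighbours in \<open>S\<close> than it needs,
    and then the weights decide\<close>
  have claim_c: "sum need W \<le> (\<Sum>s\<in>S. min 2 (card (nbh D s \<inter> W)))"
    if "W \<subseteq> E - S" "\<And>v. v \<in> W \<Longrightarrow> col v = c" for W
    using that
  proof (induction "card W" arbitrary: W rule: less_induct)
    case (less W)
    have finW: "finite W" using less.prems(1) finE by (auto intro: finite_subset)
    define priv where "priv v = {s \<in> S. s \<in> nbh D v \<and> card (nbh D s \<inter> W) = 1}" for v
    have finpriv: "finite (priv v)" for v using finS by (simp add: priv_def)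
    show ?case
    proof (cases "\<exists>v\<in>W. need v \<le> card (priv v)")
      case True
      then obtain v where v: "v \<in> W" "need v \<le> card (priv v)" by blast
      \<comment> \<open>Each private neighbour of \<open>v\<close> loses one unit when
        \<open>v\<close> is removed; together they cover \<open>need v\<close>.\<close>
      have "sum need (W - {v}) \<le> (\<Sum>s\<in>S. min 2 (card (nbh D s \<inter> (W - {v}))))"
        using less.prems by (intro less.hyps card_Diff1_less[OF finW v(1)]) auto
      moreover have "card (priv v) = (\<Sum>s\<in>S. if s \<in> priv v then 1 else 0)"
        using finS by (simp add: sum.If_cases priv_def Int_def conj_commute conj_left_commute)
      ultimately have "sum need W \<le> (\<Sum>s\<in>S. min 2 (card (nbh D s \<inter> (W - {v}))) + (if s \<in> priv v then 1 else 0))"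
        using v finW by (simp add: sum.remove[of W v] sum.distrib)
      also have "\<dots> \<le> (\<Sum>s\<in>S. min 2 (card (nbh D s \<inter> W)))"
      proof (rule sum_mono)
        fix s
        show "min 2 (card (nbh D s \<inter> (W - {v}))) + (if s \<in> priv v then 1 else 0) \<le> min 2 (card (nbh D s \<inter> W))"
        proof (cases "s \<in> priv v")
          case True
          then have "s \<in> nbh D v" "card (nbh D s \<inter> W) = 1" by (auto simp: priv_def)
          then show ?thesis using remove[of v W s] v(1) True by simp
        next
          case False
          then show ?thesis using mono[OF finW, of s v] by simp
        qed
      qed
      finally show ?thesis .
    next
      case False
      define N where "N = {s \<in> S. nbh D s \<inter> W \<noteq> {}}"
      define N' where "N' = {s \<in> N. card (nbh D s \<inter> W) = 1}"
      have finN: "finite N" using finS by (simp add: N_def)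
      \<comment> \<open>Weight 3 occurs only in colour \<open>c\<close>, and a neighbour of
        \<open>W\<close> has another colour.\<close>
      have wtN: "wt s = 2" if s: "s \<in> N" for s
      proof -
        obtain v where v: "v \<in> W" "v \<in> nbh D s" using s by (auto simp: N_def)
        then have "col s \<noteq> c" using state_nbh_col[OF st v(2)] less.prems(2) by auto
        then show ?thesis by (simp add: wt_def)
      qed
      have "sum wt W \<le> sum wt N"
        unfolding N_def by (rule max[OF less.prems(1)]) (use less.prems(2) in metis)
      then have wtW: "sum wt W \<le> 2 * card N" using wtN by simp
      have "N' \<subseteq> \<Union>(priv ` W)"
        by (auto simp: N'_def N_def priv_def nbh_sym)
      then have "card N' \<le> card (\<Union>(priv ` W))"
        using finW finpriv by (intro card_mono) auto
      also have "\<dots> \<le> (\<Sum>v\<in>W. card (priv v))" by (rule card_UN_le[OF finW])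
      also have "\<dots> \<le> (\<Sum>v\<in>W. need v - 1)"
        using False by (intro sum_mono) (metis Suc_leI diff_Suc_1 diff_le_mono not_le)
      finally have "card N' + 2 * card W \<le> (\<Sum>v\<in>W. need v - 1 + 2)"
        unfolding sum.distrib by simp
      \<comment> \<open>For colour \<open>c\<close> the need is one less than the weight and is
        positive, so \<open>need v - 1 + 2\<close> is exactly \<open>wt v\<close>.\<close>
      also have "\<dots> = sum wt W"
        using less.prems(2) by (intro sum.cong) (auto simp: need_def wt_def)
      finally have *: "card N' + 2 * card W \<le> 2 * card N" using wtW by simp
      have "sum need W \<le> 2 * card W"
        using sum_bounded_above[of W need 2] need_le by (simp add: mult.commute)
      \<comment> \<open>In the truncated sum, members of \<open>N'\<close> contribute 1 and the
        other members of \<open>N\<close> contribute 2.\<close>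
      also have "\<dots> \<le> 2 * card N - card N'" using * by simp
      also have "\<dots> \<le> (\<Sum>s\<in>N. min 2 (card (nbh D s \<inter> W)))"
      proof -
        have "2 * card N \<le> (\<Sum>s\<in>N. min 2 (card (nbh D s \<inter> W)) + (if s \<in> N' then 1 else 0))"
        proof -
          have ge: "2 \<le> min 2 (card (nbh D s \<inter> W)) + (if s \<in> N' then 1 else 0)" if "s \<in> N" for s
          proof -
            have "card (nbh D s \<inter> W) \<noteq> 0" using that finW by (simp add: N_def)
            then show ?thesis using that by (cases "card (nbh D s \<inter> W) = 1") (auto simp: N'_def)
          qed
          show ?thesis using sum_bounded_below[OF ge, of N "\<lambda>s. s"] by (simp add: mult.commute)
        qed
        also have "\<dots> = (\<Sum>s\<in>N. min 2 (card (nbh D s \<inter> W))) + card (N \<inter> N')"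
          using finN by (simp add: sum.distrib sum.If_cases)
        also have "N \<inter> N' = N'" by (auto simp: N'_def)
        finally show ?thesis by simp
      qed
      also have "\<dots> \<le> (\<Sum>s\<in>S. min 2 (card (nbh D s \<inter> W)))"
        using finS by (intro sum_mono2) (auto simp: N_def)
      finally show ?thesis .
    qed
  qed
  have "\<exists>X. picks D w h S X \<and> (\<forall>s\<in>S. X s \<noteq> {} \<longrightarrow> potential w D s = Suc h) \<and>
    (\<forall>v\<in>E - S. card {s \<in> S. v \<in> X s} + need v \<le> card (nbh D v \<inter> S))"
  proof (rule discard_choice[OF st SR indep _ k])
    show "potential w D s = h \<or> potential w D s = Suc h" if "s \<in> S" for s
      using that SE by (auto simp: E_def)
    show "E - S \<subseteq> R - S" using ER by auto
    show "need v \<le> card (nbh D v \<inter> S)" if v: "v \<in> E - S" for v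
    proof -
      have inter: "card (nbh D s \<inter> {v}) = (if s \<in> nbh D v then 1 else 0)" for s
        by (auto simp: nbh_sym)
      show ?thesis
      proof (cases "col v = c")
        case True
        then have "need v \<le> (\<Sum>s\<in>S. min 2 (card (nbh D s \<inter> {v})))"
          using claim_c[of "{v}"] v by simp
        also have "\<dots> \<le> (\<Sum>s\<in>S. if s \<in> nbh D v then 1 else 0)"
          by (intro sum_mono) (simp add: inter)
        finally show ?thesis using finS by (simp add: sum.If_cases Int_commute)
      next
        case False
        have "2 * card {v} \<le> (\<Sum>s\<in>S. \<psi> s (card (nbh D s \<inter> {v})))"
          by (rule claim[OF _ False]) (use v in auto)
        then have two: "2 \<le> (\<Sum>s\<in>S. \<psi> s (card (nbh D s \<inter> {v})))" by simp
        have "nbh D v \<inter> S \<noteq> {}"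
        proof
          assume disj: "nbh D v \<inter> S = {}"
          have "\<psi> s (card (nbh D s \<inter> {v})) = 0" if "s \<in> S" for s
          proof -
            have "s \<notin> nbh D v" using that disj by blast
            then show ?thesis by (simp add: inter \<psi>_def)
          qed
          then show False using two by simp
        qed
        then show ?thesis using False finS by (simp add: need_def Suc_le_eq card_gt_0_iff)
      qed
    qed
    fix W assume W: "W \<subseteq> E - S"
    have finW: "finite W" using W finE by (auto intro: finite_subset)
    define P where "P d = {v \<in> W. col v = d}" for d
    have finP: "finite (P d)" for d using finW by (simp add: P_def)
    have WP: "W = P a \<union> P b \<union> P c" using W cols(1) ER by (auto simp: P_def)
    have disj: "P a \<inter> P b = {}" "(P a \<union> P b) \<inter> P c = {}" using cols by (auto simp: P_def)
    have PW: "P d \<subseteq> E - S" for d using W by (auto simp: P_def)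
    have "sum need W = sum need (P a) + sum need (P b) + sum need (P c)"
      unfolding WP using finP disj by (simp add: sum.union_disjoint)
    also have "sum need (P a) = card (P a)" using cols by (simp add: need_def P_def)
    also have "sum need (P b) = card (P b)" using cols by (simp add: need_def P_def)
    finally have "2 * sum need W = 2 * card (P a) + 2 * card (P b) + 2 * sum need (P c)" by simp
    also have "\<dots> \<le> (\<Sum>s\<in>S. \<psi> s (card (nbh D s \<inter> P a))) + (\<Sum>s\<in>S. \<psi> s (card (nbh D s \<inter> P b)))
        + 2 * (\<Sum>s\<in>S. min 2 (card (nbh D s \<inter> P c)))"
      using cols by (intro add_mono mult_le_mono2 claim[of _ a] claim[of _ b] claim_c PW) (auto simp: P_def)
    also have "\<dots> = (\<Sum>s\<in>S. \<psi> s (card (nbh D s \<inter> P a)) + \<psi> s (card (nbh D s \<inter> P b))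
        + 2 * min 2 (card (nbh D s \<inter> P c)))"
      by (simp add: sum.distrib sum_distrib_left)
    also have "\<dots> \<le> (\<Sum>s\<in>S. 2 * min 3 (card (nbh D s \<inter> W)))"
    proof (rule sum_mono)
      \<comment> \<open>The colour of \<open>s\<close> itself contributes nothing. In half units,
        colour \<open>c\<close> uses at most 3 + 3, and colours \<open>a\<close> and
        \<open>b\<close> use at most 2 + 4; in each case this is three units.\<close>
      fix s assume "s \<in> S"
      then have col: "col s = a \<or> col s = b \<or> col s = c" using SR cols(1)[of s] by auto
      have "nbh D s \<inter> P (col s) = {}"
        using state_nbh_col[OF st, of _ s] by (auto simp: P_def)
      then have own: "card (nbh D s \<inter> P (col s)) = 0" by simp
      have "card (nbh D s \<inter> W) = card (nbh D s \<inter> P a) + card (nbh D s \<inter> P b) + card (nbh D s \<inter> P c)"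
      proof -
        have "nbh D s \<inter> W = (nbh D s \<inter> P a \<union> nbh D s \<inter> P b) \<union> nbh D s \<inter> P c"
          unfolding WP by blast
        moreover have "(nbh D s \<inter> P a) \<inter> (nbh D s \<inter> P b) = {}"
          "(nbh D s \<inter> P a \<union> nbh D s \<inter> P b) \<inter> (nbh D s \<inter> P c) = {}"
          using disj by blast+
        ultimately show ?thesis using finP by (simp add: card_Un_disjoint)
      qed
      then show "\<psi> s (card (nbh D s \<inter> P a)) + \<psi> s (card (nbh D s \<inter> P b))
        + 2 * min 2 (card (nbh D s \<inter> P c)) \<le> 2 * min 3 (card (nbh D s \<inter> W))"
        using col own cols by (auto simp: \<psi>_def min_def)
    qed
    also have "\<dots> = 2 * (\<Sum>s\<in>S. min 3 (card (nbh D s \<inter> W)))" by (simp add: sum_distrib_left)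
    finally show "sum need W \<le> (\<Sum>s\<in>S. min 3 (card (nbh D s \<inter> W)))" by simp
  qed
  then obtain X where X: "picks D w h S X"
    "\<And>v. v \<in> E - S \<Longrightarrow> card {s \<in> S. v \<in> X s} + need v \<le> card (nbh D v \<inter> S)"
    by blast
  have "potential (gain w S X) (remaining S D) v \<le> h \<and> (col v \<noteq> b \<longrightarrow> potential (gain w S X) (remaining S D) v < h)"
    if v: "v \<in> R - S" for v
  proof (cases "v \<in> E")
    case True
    have "potential (gain w S X) (remaining S D) v + card (nbh D v \<inter> S) = potential w D v + card {s \<in> S. v \<in> X s}"
      using potential_after_picks[OF st] v by simp
    then have "potential (gain w S X) (remaining S D) v + need v \<le> potential w D v"
      using X(2)[of v] True v by simp
    then show ?thesis
      using True low[of v] high[of v] v cols(1)[of v]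
      by (auto simp: need_def wt_def E_def split: if_splits)
  next
    case False
    then have "potential w D v \<le> h \<and> (col v \<noteq> b \<longrightarrow> potential w D v < h)"
      using high[of v] v by (auto simp: E_def)
    then show ?thesis using potential_after_picks_le[OF st X(1), of v] v by auto
  qed
  then show ?thesis using X(1) SR by blast
qed

section \<open>Three parts\<close>

text \<open>Once \<open>single_step\<close> has pushed all remaining potentials below
  \<open>h\<close>, the greedy orientation cannot repeat the value given to
  \<open>S\<close>.\<close>

lemma solvable_single_excess:
  fixes col :: "'a \<Rightarrow> 'c"
  assumes st: "state k col R D w" and k: "k + 2 \<le> h"
    and cols: "\<And>v. v \<in> R \<Longrightarrow> col v \<in> {a, b, c}" "a \<noteq> b"
    and low: "\<And>v. v \<in> R \<Longrightarrow> col v \<noteq> c \<Longrightarrow> potential w D v \<le> h"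
    and high: "\<And>v. v \<in> R \<Longrightarrow> potential w D v \<le> Suc h"
  shows "\<exists>f. solution R D w f \<and> (\<forall>v\<in>R. f v \<le> h)"
proof -
  obtain S X where S: "S \<subseteq> R" "picks D w h S X"
    and lt: "\<And>v. v \<in> R - S \<Longrightarrow> potential (gain w S X) (remaining S D) v < h"
    using single_step[OF st k cols low high] by blast
  obtain f where f: "solution (R - S) (remaining S D) (gain w S X) f"
    "\<And>v. v \<in> R - S \<Longrightarrow> f v \<le> potential (gain w S X) (remaining S D) v"
    using greedy[OF state_after_picks[OF st S]] by blast
  have fh: "f v < h" if "v \<in> R - S" for v using f(2)[OF that] lt[OF that] by simp
  have "solution R D w (\<lambda>v. if v \<in> S then h else f v)"
    by (rule solution_after_picks[OF st S f(1)]) (use fh in blast)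
  moreover have "(if v \<in> S then h else f v) \<le> h" if "v \<in> R" for v
    using fh[of v] that by auto
  ultimately show ?thesis by blast
qed

lemma solvable_double_excess:
  fixes col :: "'a \<Rightarrow> 'c"
  assumes st: "state k col R D w" and k: "k + 3 \<le> h"
    and cols: "\<And>v. v \<in> R \<Longrightarrow> col v \<in> {a, b, c}" "a \<noteq> b" "a \<noteq> c" "b \<noteq> c"
    and low: "\<And>v. v \<in> R \<Longrightarrow> col v = a \<Longrightarrow> potential w D v \<le> h"
    and high: "\<And>v. v \<in> R \<Longrightarrow> potential w D v \<le> Suc h"
  shows "\<exists>f. solution R D w f \<and> (\<forall>v\<in>R. f v \<le> h)"
proof -
  obtain S X where S: "S \<subseteq> R" "picks D w h S X"
    and le: "\<And>v. v \<in> R - S \<Longrightarrow> potential (gain w S X) (remaining S D) v \<le> h"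
    and lt: "\<And>v. v \<in> R - S \<Longrightarrow> col v \<noteq> b \<Longrightarrow> potential (gain w S X) (remaining S D) v < h"
    using double_step[OF st k cols low high] by blast
  obtain h' where h': "h = Suc h'" using k by (cases h) auto
  have "\<exists>f. solution (R - S) (remaining S D) (gain w S X) f \<and> (\<forall>v\<in>R - S. f v \<le> h')"
  \<comment> \<open>One level lower, \<open>b\<close> is the only part that may still exceed
    \<open>h'\<close>, so \<open>b\<close> and \<open>c\<close> exchange roles.\<close>
  proof (rule solvable_single_excess[OF state_after_picks[OF st S], where a = a and b = c and c = b])
    show "col v \<in> {a, c, b}" if "v \<in> R - S" for v using cols(1)[of v] that by auto
    show "potential (gain w S X) (remaining S D) v \<le> h'" if "v \<in> R - S" "col v \<noteq> b" for v
      using lt[OF that] h' by simp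
  qed (use k h' cols le in auto)
  then obtain f where f: "solution (R - S) (remaining S D) (gain w S X) f" "\<And>v. v \<in> R - S \<Longrightarrow> f v \<le> h'"
    by blast
  have fh: "f v < h" if "v \<in> R - S" for v using f(2)[OF that] h' by simp
  have "solution R D w (\<lambda>v. if v \<in> S then h else f v)"
    by (rule solution_after_picks[OF st S f(1)]) (use fh in blast)
  moreover have "(if v \<in> S then h else f v) \<le> h" if "v \<in> R" for v
    using fh[of v] that by auto
  ultimately show ?thesis by blast
qed

text \<open>The value \<open>T\<close> is skipped: \<open>S\<close> receives \<open>T + 1\<close>,
  and everything else ends at most at \<open>T - 1\<close>. The choice \<open>T = k + 4\<close> is
  the least for which \<open>double_step\<close> applies at \<open>T - 1\<close>.\<close>

lemma solvable_bounded:
  fixes col :: "'a \<Rightarrow> 'c"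
  assumes st: "state k col R D w" and T: "T = k + 4"
    and cols: "\<And>v. v \<in> R \<Longrightarrow> col v \<in> {a, b, c}" "a \<noteq> b" "a \<noteq> c" "b \<noteq> c"
    and bnd: "\<And>v. v \<in> R \<Longrightarrow> col v = a \<Longrightarrow> potential w D v < T"
      "\<And>v. v \<in> R \<Longrightarrow> col v = b \<Longrightarrow> potential w D v < T + 2"
      "\<And>v. v \<in> R \<Longrightarrow> col v = c \<Longrightarrow> potential w D v < T + 3"
  shows "\<exists>f. solution R D w f \<and> (\<forall>v\<in>R. f v < T + 2 \<and> f v \<noteq> T)"
proof -
  have "\<exists>S X. S \<subseteq> R \<and> picks D w (T + 1) S X \<and> (\<forall>v\<in>R - S. potential (gain w S X) (remaining S D) v < T + 1)"
  proof (rule single_step[OF st _ cols(1,2)])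
    show "potential w D v \<le> T + 1" if "v \<in> R" "col v \<noteq> c" for v
      using cols(1)[of v] bnd(1,2)[of v] that by auto
    show "potential w D v \<le> Suc (T + 1)" if "v \<in> R" for v
      using cols(1)[of v] bnd[of v] that by auto
  qed (use T in auto)
  then obtain S X where S: "S \<subseteq> R" "picks D w (T + 1) S X"
    and lt: "\<And>v. v \<in> R - S \<Longrightarrow> potential (gain w S X) (remaining S D) v < T + 1"
    by blast
  \<comment> \<open>Potentials never rise, so part \<open>a\<close> is still below \<open>T\<close>,
    while \<open>b\<close> and \<open>c\<close> exceed \<open>T - 1 = k + 3\<close> by at most
    one.\<close>
  have "\<exists>f. solution (R - S) (remaining S D) (gain w S X) f \<and> (\<forall>v\<in>R - S. f v \<le> k + 3)"
  proof (rule solvable_double_excess[OF state_after_picks[OF st S] _ _ cols(2,3,4)])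
    show "col v \<in> {a, b, c}" if "v \<in> R - S" for v using cols(1)[of v] that by auto
    show "potential (gain w S X) (remaining S D) v \<le> k + 3" if "v \<in> R - S" "col v = a" for v
      using potential_after_picks_le[OF st S(2), of v] bnd(1)[of v] that T by auto
    show "potential (gain w S X) (remaining S D) v \<le> Suc (k + 3)" if "v \<in> R - S" for v
      using lt[OF that] T by simp
  qed simp
  then obtain f where f: "solution (R - S) (remaining S D) (gain w S X) f" "\<And>v. v \<in> R - S \<Longrightarrow> f v \<le> k + 3"
    by blast
  have fh: "f v < T" if "v \<in> R - S" for v using f(2)[OF that] T by simp
  have "solution R D w (\<lambda>v. if v \<in> S then T + 1 else f v)"
    by (rule solution_after_picks[OF st S f(1)]) (use fh in fastforce)
  moreover have "(if v \<in> S then T + 1 else f v) < T + 2 \<and> (if v \<in> S then T + 1 else f v) \<noteq> T"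
    if "v \<in> R" for v
    using fh[of v] that by auto
  ultimately show ?thesis by blast
qed

text \<open>The vertices of colour \<open>c\<close> with potential at least \<open>h\<close> form an
  independent set, and \<open>k \<le> h\<close> guarantees enough edges to give up. All others must
  then avoid \<open>h\<close>; the predicate \<open>Q\<close> accumulates such constraints, so that
  caps can be nested.\<close>

lemma solvable_cap_color:
  assumes st: "state k col R D w" and k: "k \<le> h"
    and IH: "\<And>R' D' w'. state k col R' D' w' \<Longrightarrow> R' \<subseteq> R \<Longrightarrow>
      (\<And>v. v \<in> R' \<Longrightarrow> potential w' D' v \<le> potential w D v) \<Longrightarrow>
      (\<And>v. v \<in> R' \<Longrightarrow> col v = c \<Longrightarrow> potential w' D' v < h) \<Longrightarrow>
      \<exists>f. solution R' D' w' f \<and> (\<forall>v\<in>R'. f v \<noteq> h \<and> Q (f v))"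
    and Qh: "Q h"
  shows "\<exists>f. solution R D w f \<and> (\<forall>v\<in>R. Q (f v))"
proof -
  define S where "S = {v \<in> R. col v = c \<and> h \<le> potential w D v}"
  have SR: "S \<subseteq> R" by (auto simp: S_def)
  have "\<exists>A. A \<subseteq> {x. (x, s) \<in> D} \<and> card A = potential w D s - h" if "s \<in> S" for s
  proof -
    have "potential w D s - h \<le> card {x. (x, s) \<in> D}"
      using card_in_arcs[OF st, of s] that SR k by auto
    then show ?thesis by (meson obtain_subset_with_card_n)
  qed
  then obtain X where X: "\<And>s. s \<in> S \<Longrightarrow> X s \<subseteq> {x. (x, s) \<in> D} \<and> card (X s) = potential w D s - h"
    by metis
  have "(s, t) \<notin> D" if "s \<in> S" "t \<in> S" for s t
  proof
    assume "(s, t) \<in> D"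
    then have "col s \<noteq> col t" using st by (simp add: state_def)
    then show False using that by (simp add: S_def)
  qed
  then have p: "picks D w h S X"
    using X by (auto simp: picks_def S_def)
  obtain f where f: "solution (R - S) (remaining S D) (gain w S X) f" "\<And>v. v \<in> R - S \<Longrightarrow> f v \<noteq> h \<and> Q (f v)"
  proof -
    have "\<exists>f. solution (R - S) (remaining S D) (gain w S X) f \<and> (\<forall>v\<in>R - S. f v \<noteq> h \<and> Q (f v))"
    proof (rule IH[OF state_after_picks[OF st SR p]])
      show le: "potential (gain w S X) (remaining S D) v \<le> potential w D v" if "v \<in> R - S" for v
        using potential_after_picks_le[OF st p] that by simp
      show "potential (gain w S X) (remaining S D) v < h" if "v \<in> R - S" "col v = c" for v
        using le[OF that(1)] that by (auto simp: S_def)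
    qed simp
    then show thesis using that by blast
  qed
  have "solution R D w (\<lambda>v. if v \<in> S then h else f v)"
    by (rule solution_after_picks[OF st SR p f(1)]) (use f(2) in blast)
  moreover have "Q (if v \<in> S then h else f v)" if "v \<in> R" for v
    using f(2)[of v] that Qh by auto
  ultimately show ?thesis by blast
qed

lemma solvable_three_colors:
  fixes col :: "'a \<Rightarrow> 'c"
  assumes st: "state k col R D w"
    and cols: "\<And>v. v \<in> R \<Longrightarrow> col v \<in> {a, b, c}" "a \<noteq> b" "a \<noteq> c" "b \<noteq> c"
  shows "\<exists>f. solution R D w f \<and> (\<forall>v\<in>R. f v \<le> k + 7)"
proof -
  \<comment> \<open>The caps are \<open>T\<close>, \<open>T + 2\<close> and \<open>T + 3\<close>;
    the last one is the source of the constant 7.\<close>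
  define T where "T = k + 4"
  have "\<exists>f. solution R D w f \<and> (\<forall>v\<in>R. f v \<le> T + 3)"
  proof (rule solvable_cap_color[OF st, where c = a and h = T])
    fix R1 D1 and w1 :: "'a \<Rightarrow> nat"
    assume 1: "state k col R1 D1 w1" "R1 \<subseteq> R" "\<And>v. v \<in> R1 \<Longrightarrow> col v = a \<Longrightarrow> potential w1 D1 v < T"
    show "\<exists>f. solution R1 D1 w1 f \<and> (\<forall>v\<in>R1. f v \<noteq> T \<and> f v \<le> T + 3)"
    proof (rule solvable_cap_color[OF 1(1), where c = b and h = "T + 2"])
      fix R2 D2 and w2 :: "'a \<Rightarrow> nat"
      assume 2: "state k col R2 D2 w2" "R2 \<subseteq> R1" "\<And>v. v \<in> R2 \<Longrightarrow> potential w2 D2 v \<le> potential w1 D1 v"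
        "\<And>v. v \<in> R2 \<Longrightarrow> col v = b \<Longrightarrow> potential w2 D2 v < T + 2"
      show "\<exists>f. solution R2 D2 w2 f \<and> (\<forall>v\<in>R2. f v \<noteq> T + 2 \<and> f v \<noteq> T \<and> f v \<le> T + 3)"
      proof (rule solvable_cap_color[OF 2(1), where c = c and h = "T + 3"])
        fix R3 D3 and w3 :: "'a \<Rightarrow> nat"
        assume 3: "state k col R3 D3 w3" "R3 \<subseteq> R2" "\<And>v. v \<in> R3 \<Longrightarrow> potential w3 D3 v \<le> potential w2 D2 v"
          "\<And>v. v \<in> R3 \<Longrightarrow> col v = c \<Longrightarrow> potential w3 D3 v < T + 3"
        have "\<exists>f. solution R3 D3 w3 f \<and> (\<forall>v\<in>R3. f v < T + 2 \<and> f v \<noteq> T)"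
        proof (rule solvable_bounded[OF 3(1) T_def _ cols(2,3,4)])
          fix v assume v: "v \<in> R3"
          then have sub: "v \<in> R2" "v \<in> R1" "v \<in> R" using 3(2) 2(2) 1(2) by auto
          show "col v \<in> {a, b, c}" using cols(1) sub by simp
          show "potential w3 D3 v < T" if "col v = a"
            using 3(3)[OF v] 2(3)[OF sub(1)] 1(3)[OF sub(2) that] by simp
          show "potential w3 D3 v < T + 2" if "col v = b"
            using 3(3)[OF v] 2(4)[OF sub(1) that] by simp
          show "potential w3 D3 v < T + 3" if "col v = c" using 3(4)[OF v that] .
        qed
        then show "\<exists>f. solution R3 D3 w3 f \<and> (\<forall>v\<in>R3. f v \<noteq> T + 3 \<and> f v \<noteq> T + 2 \<and> f v \<noteq> T \<and> f v \<le> T + 3)"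
          by fastforce
      qed (auto simp: T_def)
    qed (auto simp: T_def)
  qed (auto simp: T_def)
  moreover have "T + 3 = k + 7" by (simp add: T_def)
  ultimately show ?thesis by simp
qed

section \<open>From density to orientations\<close>

text \<open>Hall's theorem assigns every edge to an endpoint as its owner, with capacity
  \<open>k\<close> at each vertex. A set \<open>Q\<close> of edges has
  \<open>k * card (\<Union>Q)\<close> places available.\<close>

lemma ex_orientation_outd_le:
  assumes "pair_graph G"
    and dens: "\<And>Q. Q \<subseteq> uedges G \<Longrightarrow> card Q \<le> k * card (\<Union>Q)"
  shows "\<exists>D. D \<subseteq> parcs G \<and> D \<union> D\<inverse> = parcs G \<and> (\<forall>u v. (u, v) \<in> D \<longrightarrow> (v, u) \<notin> D) \<and>
    (\<forall>v. outd D v \<le> k)"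
proof -
  interpret pair_graph G by fact
  have sym: "(v, u) \<in> parcs G" if "(u, v) \<in> parcs G" for u v
    using that arcs_symmetric by blast
  have irr: "u \<noteq> v" if "(u, v) \<in> parcs G" for u v using that no_loops' by blast
  have eq: "uedges G = (\<lambda>(u, v). {u, v}) ` parcs G" by (auto simp: uedges_def)
  have fin: "finite (uedges G)" unfolding eq by (intro finite_imageI) simp
  have "\<exists>g. (\<forall>e\<in>uedges G. g e \<in> e) \<and> (\<forall>v. card {e \<in> uedges G. g e = v} \<le> k)"
  proof (rule hall_capacity[OF fin, of "\<lambda>e. e" "\<lambda>_. k"])
    show "finite e" if "e \<in> uedges G" for e using that by (auto simp: uedges_def)
    show "card Q \<le> (\<Sum>_\<in>\<Union>((\<lambda>e. e) ` Q). k)" if "Q \<subseteq> uedges G" for Q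
      using dens[OF that] by (simp add: mult.commute)
  qed
  then obtain g where g: "\<And>e. e \<in> uedges G \<Longrightarrow> g e \<in> e" "\<And>v. card {e \<in> uedges G. g e = v} \<le> k"
    by blast
  define D where "D = {(u, v) \<in> parcs G. g {u, v} = u}"
  have "(u, v) \<in> D \<or> (v, u) \<in> D" if "(u, v) \<in> parcs G" for u v
  proof -
    have "{u, v} \<in> uedges G" using that by (auto simp: uedges_def)
    then have "g {u, v} = u \<or> g {u, v} = v" using g(1) by blast
    then show ?thesis using that sym by (auto simp: D_def insert_commute)
  qed
  then have "D \<union> D\<inverse> = parcs G" using sym by (auto simp: D_def)
  moreover have "(v, u) \<notin> D" if "(u, v) \<in> D" for u v
    using that irr[of u v] by (auto simp: D_def insert_commute)
  moreover have "outd D v \<le> k" for v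
  proof -
    have "outd D v = card ((\<lambda>u. {v, u}) ` {u. (v, u) \<in> D})"
      unfolding outd_def by (subst card_image) (auto simp: inj_on_def doubleton_eq_iff)
    also have "\<dots> \<le> card {e \<in> uedges G. g e = v}"
      using fin by (intro card_mono) (auto simp: D_def uedges_def)
    finally show ?thesis using g(2)[of v] by simp
  qed
  ultimately show ?thesis by (intro exI[of _ D]) (auto simp: D_def)
qed

section \<open>Maximum average degree as a bound on the density of edge sets\<close>

lemma density_le_Mad:
  assumes G: "pair_graph G"
    and H: "pair_graph H" "subgraph (with_proj H) (with_proj G)" "pverts H \<noteq> {}"
  shows "2 * real (card (uedges H)) / real (card (pverts H)) \<le> Mad G"
proof -
  interpret pair_graph G by fact
  define \<H> where "\<H> = {H. pair_graph H \<and> subgraph (with_proj H) (with_proj G) \<and> pverts H \<noteq> {}}"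
  \<comment> \<open>A subgraph is determined by its vertex and arc sets, so the maximum ranges over
    a finite family.\<close>
  have "\<H> \<subseteq> (\<lambda>(V, A). \<lparr>pverts = V, parcs = A\<rparr>) ` (Pow (pverts G) \<times> Pow (parcs G))"
  proof
    fix H assume "H \<in> \<H>"
    then have "pverts H \<subseteq> pverts G" "parcs H \<subseteq> parcs G"
      by (auto simp: \<H>_def subgraph_def)
    then show "H \<in> (\<lambda>(V, A). \<lparr>pverts = V, parcs = A\<rparr>) ` (Pow (pverts G) \<times> Pow (parcs G))"
      by (intro image_eqI[of _ _ "(pverts H, parcs H)"]) auto
  qed
  then have "finite \<H>" by (rule finite_subset) simp
  then show ?thesis
    unfolding Mad_def using H by (intro Max_ge) (auto simp: \<H>_def)
qed

lemma Mad_nonneg: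
  assumes "pair_graph G" and "pverts G \<noteq> {}"
  shows "0 \<le> Mad G"
proof -
  interpret pair_graph G by fact
  have "subgraph (with_proj G) (with_proj G)" by (rule subgraph_refl)
  from order_trans[OF _ density_le_Mad[OF assms(1) assms(1) this assms(2)]]
  show ?thesis by simp
qed

text \<open>The edges of \<open>Q\<close> together with their endpoints form a subgraph of
  \<open>G\<close>, which competes in the maximum.\<close>

lemma card_le_Mad:
  assumes G: "pair_graph G" and Q: "Q \<subseteq> uedges G" "Q \<noteq> {}"
  shows "2 * real (card Q) \<le> Mad G * real (card (\<Union>Q))"
proof -
  interpret pair_graph G by fact
  have sym: "(v, u) \<in> parcs G" if "(u, v) \<in> parcs G" for u v
    using that arcs_symmetric by blast
  define H where "H = \<lparr>pverts = \<Union>Q, parcs = {(u, v). {u, v} \<in> Q}\<rparr>"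
  have arcs: "(u, v) \<in> parcs G" if "{u, v} \<in> Q" for u v
  proof -
    have "{u, v} \<in> uedges G" using that Q(1) by blast
    then obtain x y where "{u, v} = {x, y}" "(x, y) \<in> parcs G" unfolding uedges_def by blast
    then show ?thesis using sym[of x y] by (auto simp: doubleton_eq_iff)
  qed
  have sub: "pverts H \<subseteq> pverts G" "parcs H \<subseteq> parcs G"
  proof -
    have "e \<subseteq> pverts G" if "e \<in> uedges G" for e
      using that in_arcsD1 in_arcsD2 unfolding uedges_def by blast
    then have "\<Union>Q \<subseteq> pverts G" using Q(1) by (meson Sup_least subsetD)
    then show "pverts H \<subseteq> pverts G" by (simp add: H_def)
    show "parcs H \<subseteq> parcs G" using arcs by (auto simp: H_def)
  qed
  have pH: "pair_graph H"
  proof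
    show "finite (pverts H)" using finite_subset[OF sub(1)] by simp
    show "finite (parcs H)" using finite_subset[OF sub(2)] by simp
    show "fst e \<in> pverts H" "snd e \<in> pverts H" if "e \<in> parcs H" for e
      using that by (auto simp: H_def)
    show "fst e \<noteq> snd e" if "e \<in> parcs H" for e
      using that sub no_loops by auto
    show "symmetric H" unfolding symmetric_def by (auto simp: H_def insert_commute intro!: symI)
  qed
  interpret H: pair_graph H by (rule pH)
  have ne: "pverts H \<noteq> {}"
  proof -
    obtain e where e: "e \<in> Q" using Q(2) by blast
    then obtain x y where "e = {x, y}" using Q(1) unfolding uedges_def by blast
    then have "x \<in> pverts H" using e by (auto simp: H_def)
    then show ?thesis by blast
  qed
  have "wf_digraph (with_proj G)" "wf_digraph (with_proj H)" by unfold_locales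
  then have "subgraph (with_proj H) (with_proj G)"
    using sub by (intro subgraphI) (auto simp: compatible_def)
  then have "2 * real (card (uedges H)) / real (card (pverts H)) \<le> Mad G"
    by (rule density_le_Mad[OF G pH _ ne])
  moreover have "uedges H = Q"
  proof
    show "uedges H \<subseteq> Q" by (auto simp: H_def uedges_def)
    show "Q \<subseteq> uedges H"
    proof
      fix e assume e: "e \<in> Q"
      then obtain x y where "e = {x, y}" using Q(1) unfolding uedges_def by blast
      then show "e \<in> uedges H" using e by (auto simp: H_def uedges_def)
    qed
  qed
  moreover have "0 < card (pverts H)"
    using ne by (simp add: card_gt_0_iff)
  ultimately show ?thesis by (simp add: H_def divide_le_eq)
qed

section \<open>From solutions back to proper orientations\<close>

lemma out_degree_eq_outd: "out_degree (with_proj H) v = outd (parcs H) v"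
proof -
  have "out_arcs (with_proj H) v = Pair v ` {u. (v, u) \<in> parcs H}"
    by (auto simp: out_arcs_def)
  then show ?thesis by (simp add: out_degree_def outd_def card_image inj_on_def)
qed

lemma proper_orientation_number_le:
  assumes G: "pair_graph G" and H: "proper_orientation H G" and m: "max_out_degree H \<le> m"
  shows "proper_orientation_number G \<le> m"
proof -
  interpret pair_graph G by fact
  have "{D. proper_orientation D G} \<subseteq> (\<lambda>A. \<lparr>pverts = pverts G, parcs = A\<rparr>) ` Pow (parcs G)"
  proof
    fix D assume "D \<in> {D. proper_orientation D G}"
    then have "pverts D = pverts G" "parcs D \<subseteq> parcs G"
      by (auto simp: proper_orientation_def orientation_def)
    then show "D \<in> (\<lambda>A. \<lparr>pverts = pverts G, parcs = A\<rparr>) ` Pow (parcs G)"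
      by (intro image_eqI[of _ _ "parcs D"]) auto
  qed
  then have "finite {D. proper_orientation D G}" by (rule finite_subset) simp
  then have "finite {max_out_degree D |D. proper_orientation D G}" by simp
  then have "proper_orientation_number G \<le> max_out_degree H"
    unfolding proper_orientation_number_def using H by (intro Min_le) auto
  then show ?thesis using m by simp
qed

theorem theorem1p4:
  fixes G :: "'a pair_pre_digraph"
  assumes "pair_graph G"
    and "pverts G \<noteq> {}"
    and "three_partite G"
  shows "int (proper_orientation_number G) \<le> \<lceil>Mad G / 2\<rceil> + 7"
proof -
  interpret pair_graph G by fact
  define k where "k = nat \<lceil>Mad G / 2\<rceil>"
  have dens: "card Q \<le> k * card (\<Union>Q)" if Q: "Q \<subseteq> uedges G" for Q
  proof (cases "Q = {}")
    case False
    have "2 * real (card Q) \<le> Mad G * real (card (\<Union>Q))"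
      by (rule card_le_Mad[OF assms(1) Q False])
    also have "\<dots> \<le> 2 * real k * real (card (\<Union>Q))"
    proof (rule mult_right_mono)
      have "Mad G / 2 \<le> of_int \<lceil>Mad G / 2\<rceil>" by (rule le_of_int_ceiling)
      also have "\<dots> \<le> real k" by (simp add: k_def)
      finally show "Mad G \<le> 2 * real k" by simp
    qed simp
    finally have "real (card Q) \<le> real (k * card (\<Union>Q))" by simp
    then show ?thesis by (simp only: of_nat_le_iff)
  qed simp
  obtain D where D: "D \<subseteq> parcs G" "D \<union> D\<inverse> = parcs G" "\<And>u v. (u, v) \<in> D \<Longrightarrow> (v, u) \<notin> D"
    "\<And>v. outd D v \<le> k"
    using ex_orientation_outd_le[OF assms(1) dens] by blast
  obtain A B C where parts: "pverts G = A \<union> B \<union> C" "A \<inter> B = {}" "A \<inter> C = {}" "B \<inter> C = {}"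
    and indep: "independent_set G A" "independent_set G B" "independent_set G C"
    using assms(3) unfolding three_partite_def by blast
  define col :: "'a \<Rightarrow> nat" where "col v = (if v \<in> A then 0 else if v \<in> B then 1 else 2)" for v
  have DV: "u \<in> pverts G \<and> v \<in> pverts G" if "(u, v) \<in> D" for u v
    using that D(1) in_arcsD1 in_arcsD2 by blast
  have "col u \<noteq> col v" if "(u, v) \<in> D" for u v
  proof -
    have "(u, v) \<in> parcs G" using that D(1) by blast
    then have "\<not> (u \<in> P \<and> v \<in> P)" if "independent_set G P" for P
      using that by (auto simp: independent_set_def)
    from this[OF indep(1)] this[OF indep(2)] this[OF indep(3)] show ?thesis
      using DV[OF that] parts(1) by (auto simp: col_def split: if_splits)
  qed
  \<comment> \<open>At the start nothing is fixed: \<open>w\<close> vanishes, and the owner bound is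
    the out-degree bound for \<open>D\<close>.\<close>
  then have "state k col (pverts G) D (\<lambda>_. 0)"
    using D(3,4) DV finite_verts by (auto simp: state_def)
  then have "\<exists>f. solution (pverts G) D (\<lambda>_. 0) f \<and> (\<forall>v\<in>pverts G. f v \<le> k + 7)"
    by (rule solvable_three_colors[where a = 0 and b = 1 and c = 2]) (auto simp: col_def)
  then obtain f where f: "solution (pverts G) D (\<lambda>_. 0) f" "\<And>v. v \<in> pverts G \<Longrightarrow> f v \<le> k + 7"
    by blast
  from f(1) obtain F where F: "reorients F D" "\<And>u v. (u, v) \<in> D \<Longrightarrow> f u \<noteq> f v"
    "\<And>v. v \<in> pverts G \<Longrightarrow> f v = 0 + outd F v"
    unfolding solution_def by blast
  define H where "H = \<lparr>pverts = pverts G, parcs = F\<rparr>"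
  have FG: "F \<union> F\<inverse> = parcs G" and asym: "\<And>u v. (u, v) \<in> F \<Longrightarrow> (v, u) \<notin> F"
    using F(1) D(2) by (auto simp: reorients_def)
  have "orientation H G"
    unfolding orientation_def H_def using FG asym by auto
  moreover have "outd F u \<noteq> outd F v" if uv: "(u, v) \<in> parcs G" for u v
  proof -
    have "u \<in> pverts G" "v \<in> pverts G" using uv in_arcsD1 in_arcsD2 by blast+
    moreover have "(u, v) \<in> D \<or> (v, u) \<in> D" using uv D(2) by blast
    ultimately show ?thesis using F(2)[of u v] F(2)[of v u] F(3)[of u] F(3)[of v] by auto
  qed
  ultimately have "proper_orientation H G"
    by (simp add: proper_orientation_def out_degree_eq_outd H_def)
  moreover have "max_out_degree H \<le> k + 7"
    unfolding max_out_degree_def out_degree_eq_outd H_def using assms(2) finite_verts F(3) f(2)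
    by (subst Max_le_iff) auto
  ultimately have "proper_orientation_number G \<le> k + 7"
    by (rule proper_orientation_number_le[OF assms(1)])
  \<comment> \<open>The density is nonnegative, so \<open>nat\<close> in the definition of
    \<open>k\<close> truncates nothing.\<close>
  moreover have "int k = \<lceil>Mad G / 2\<rceil>" using Mad_nonneg[OF assms(1,2)] by (simp add: k_def)
  ultimately show ?thesis by linarith
qed

end
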